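(* For $\mathcal L_2$-almost every $\lambda\in\mathcal M\cap B_{1/\sqrt2}(0)$ we have $\dim_H(A_\lambda)=s(\lambda)$. Moreover, for any $0<r<R<1/\sqrt2$, $$\dim_H\{\lambda\in\mathcal M:\ r<|\lambda|<R,\ \dim_H A_\lambda<s(\lambda)\}\le\frac{\log2}{-\log R}<2.$$
   Context: $\mathcal L_2$ is Lebesgue (area) measure on $\mathbb C$; $B_r(0)$ is the open disc of radius $r$ about $0$. $A_\lambda=\{\sum_{n\ge0}a_n\lambda^n:a_n\in\{-1,1\}\}$ and $\mathcal M=\{\lambda\in\mathbb D:\ \exists (a_k)_{k\ge1},\ a_k\in\{-1,0,1\},\ 1+\sum_{k\ge1}a_k\lambda^k=0\}$ (the set of $\lambda$ in the unit disc $\mathbb D$ with $A_\lambda$ connected). $s(\lambda)=\frac{\log2}{-\log|\lambda|}$ is the similarity dimension. $\dim_H$ is Hausdorff dimension. *)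

theory Defs
  imports "HOL-Analysis.Analysis"
begin

text \<open>Contribution of one covering set to the s-dimensional Hausdorff sum:
  |U|^s, with the conventions |{}|^s = 0 and (for nonempty U of diameter 0) 0^s = 0 for s > 0.\<close>
definition hcost :: "real \<Rightarrow> 'a::metric_space set \<Rightarrow> ennreal" where
  "hcost s U = (if U = {} then 0 else ennreal (diameter U powr s))"

definition hausdorff_pre :: "real \<Rightarrow> real \<Rightarrow> 'a::metric_space set \<Rightarrow> ennreal" where
  "hausdorff_pre s \<delta> E =
     (INF U \<in> {U :: nat \<Rightarrow> 'a set. E \<subseteq> (\<Union>i. U i) \<and> (\<forall>i. bounded (U i) \<and> diameter (U i) \<le> \<delta>)}.
        (\<Sum>i. hcost s (U i)))"

definition hausdorff_measure :: "real \<Rightarrow> 'a::metric_space set \<Rightarrow> ennreal" where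
  "hausdorff_measure s E = (SUP \<delta> \<in> {0<..}. hausdorff_pre s \<delta> E)"

definition hausdorff_dim :: "'a::metric_space set \<Rightarrow> real" where
  "hausdorff_dim E = Inf {s. s > 0 \<and> hausdorff_measure s E = 0}"

definition A_set :: "complex \<Rightarrow> complex set" where
  "A_set z = {(\<Sum>n. of_int (a n) * z ^ n) | a. \<forall>n. a n \<in> {-1, 1}}"

definition M_set :: "complex set" where
  "M_set = {z. norm z < 1 \<and> (\<exists>a :: nat \<Rightarrow> int. (\<forall>k. a k \<in> {-1, 0, 1}) \<and>
                 1 + (\<Sum>k. of_int (a (Suc k)) * z ^ (Suc k)) = 0)}"

definition sim_dim :: "complex \<Rightarrow> real" where
  "sim_dim z = ln 2 / (- ln (norm z))"

end

theory Submission
  imports Defs "HOL-Real_Asymp.Real_Asymp"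
begin

text \<open>
  For words u, v of length m over {-1, 1} write u(z), v(z) for the sums of their letters against
  powers of z, and let N m be the number of pairs with |u(z) - v(z)| \<le> K |z|^m. If
  N m = O(2^(m(1 + \<epsilon>))), then most words have few neighbours at every scale, and a finite mass
  distribution argument gives dim A_z \<ge> (1 - \<epsilon>) s(z). So it suffices to bound the set of z, |z| \<le> R,
  for which N m / 2^(m(1 + \<epsilon>)) is unbounded.

  No transversality is available, since power series with coefficients -1, 0, 1 may have multiple
  zeros in the disc; but their multiplicity is bounded uniformly, so some derivative of order at
  most J is bounded below. At a level m where N m / 2^(m(1 + \<epsilon>)) is a record, a fixed proportion of
  the close pairs differ in the first letter. For each of them choose the first derivative order
  i + 1 at which u(z) - v(z) is not small, on a scale k = m div q^i: then the prefixes of length k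
  have an i-th derivative of size about R^k at z and a much larger (i + 1)-st derivative, so z is
  determined by the prefixes up to about R^k. Each pair of prefixes has at most 36 N (m - k)
  extensions, so by the record property z sees at least c 2^(k(1 + \<epsilon>)) of the 4^k pairs of
  prefixes. Hence about 2^(k(1 - \<epsilon>)) discs of radius about R^k cover all such z, and the
  s-th powers of their diameters are summable over k for s = log 2 / (- log R).
\<close>

section \<open>Hausdorff null sets\<close>

text \<open>A fixed threshold for the derivatives would not do. Cutting a pair down to prefixes of
  length k costs about \<open>R^k\<close>, so a derivative counts as large only well above that
  error. The threshold \<open>R^(m div q^i)\<close> therefore grows with the order i: at the
  crossing, an order below about \<open>R^k\<close> is followed by one above
  \<open>R^(k div q)\<close>, which dominates both the truncation error and the value. Order 0
  starts small because the pair is close, and some order at most J is at least a constant, so a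
  first crossing exists. The price is paid in \<open>\<tau> = R^(k div q) / 2\<close>: a prefix pair
  determines z only locally, up to about \<open>\<tau>^-2\<close> discs of radius about
  \<open>R^k / \<tau>\<close>. As q may be large depending on \<epsilon>, this loss stays below
  \<open>2^(\<epsilon> k / 2)\<close>, up to polynomial factors in k. With \<open>R^s = 1/2\<close>
  the cost at level k is then about \<open>4^k 2^(-k(1 + \<epsilon>)) 2^(-k) 2^(\<epsilon> k / 2) =
  2^(-\<epsilon> k / 2)\<close>. The record level enters twice: it makes pairs with equal first
  letters a share of at most \<open>2^(-\<epsilon>)\<close>, and it bounds the extensions of a
  prefix pair.\<close>

lemma hcost_eq: "hcost s U = ennreal (diameter U powr s)"
  \<comment> \<open>The empty set has diameter 0 and \<open>0 powr s\<close> is 0, so both cases of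
    the definition agree.\<close>
  by (simp add: hcost_def)

lemma hausdorff_pre_le:
  assumes "E \<subseteq> (\<Union>i. U i)" "\<And>i. bounded (U i)" "\<And>i. diameter (U i) \<le> \<delta>"
  shows "hausdorff_pre s \<delta> E \<le> (\<Sum>i. hcost s (U i))"
  unfolding hausdorff_pre_def by (rule INF_lower) (use assms in auto)

lemma hausdorff_pre_mono:
  assumes "E \<subseteq> F" shows "hausdorff_pre s \<delta> E \<le> hausdorff_pre s \<delta> F"
  unfolding hausdorff_pre_def by (rule INF_superset_mono) (use assms in auto)

lemma hausdorff_pre_coverE:
  assumes "hausdorff_pre s \<delta> E < c"
  obtains U where "E \<subseteq> (\<Union>i. U i)" "\<And>i. bounded (U i)" "\<And>i. diameter (U i) \<le> \<delta>"
    "(\<Sum>i. hcost s (U i)) < c"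
  using assms unfolding hausdorff_pre_def INF_less_iff by blast

text \<open>Covers of the \<open>E k\<close> that are optimal up to \<open>e / 2^(k + 1)\<close> are
  merged into one sequence by \<open>prod_decode\<close>; the errors add up to e.\<close>

lemma hausdorff_pre_UN:
  fixes E :: "nat \<Rightarrow> 'a::metric_space set"
  shows "hausdorff_pre s \<delta> (\<Union>k. E k) \<le> (\<Sum>k. hausdorff_pre s \<delta> (E k))"
proof (rule ennreal_le_epsilon)
  fix e :: real assume e: "0 < e" and fin: "(\<Sum>k. hausdorff_pre s \<delta> (E k)) < top"
  have fink: "hausdorff_pre s \<delta> (E k) < top" for k
    using fin ennreal_suminf_lessD by blast
  have "\<exists>U. E k \<subseteq> (\<Union>i. U i) \<and> (\<forall>i. bounded (U i) \<and> diameter (U i) \<le> \<delta>) \<and>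
          (\<Sum>i. hcost s (U i)) < hausdorff_pre s \<delta> (E k) + ennreal (e * (1/2) ^ Suc k)" for k
  proof -
    have "hausdorff_pre s \<delta> (E k) + 0 < hausdorff_pre s \<delta> (E k) + ennreal (e * (1/2) ^ Suc k)"
      unfolding ennreal_add_left_cancel_less using fink[of k] e by (simp add: less_top)
    then have "hausdorff_pre s \<delta> (E k) < hausdorff_pre s \<delta> (E k) + ennreal (e * (1/2) ^ Suc k)"
      unfolding add_0_right .
    then show ?thesis
      by (rule hausdorff_pre_coverE) (intro exI conjI allI)
  qed
  then obtain U where U: "\<And>k. E k \<subseteq> (\<Union>i. U k i)" "\<And>k i. bounded (U k i)"
    "\<And>k i. diameter (U k i) \<le> \<delta>"
    "\<And>k. (\<Sum>i. hcost s (U k i)) < hausdorff_pre s \<delta> (E k) + ennreal (e * (1/2) ^ Suc k)"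
    using that by (meson choice_iff)
  define V where "V n = (case prod_decode n of (k, i) \<Rightarrow> U k i)" for n
  have "hausdorff_pre s \<delta> (\<Union>k. E k) \<le> (\<Sum>n. hcost s (V n))"
  proof (rule hausdorff_pre_le)
    show "(\<Union>k. E k) \<subseteq> (\<Union>n. V n)"
    proof
      fix x assume "x \<in> (\<Union>k. E k)"
      then obtain k i where "x \<in> U k i" using U(1) by blast
      then have "x \<in> V (prod_encode (k, i))" by (simp add: V_def)
      then show "x \<in> (\<Union>n. V n)" by blast
    qed
  qed (auto simp: V_def U split: prod.split)
  also have "\<dots> = (\<Sum>n. (\<lambda>(k, i). hcost s (U k i)) (prod_decode n))"
    by (simp add: V_def case_prod_unfold)
  also have "\<dots> = (\<Sum>k. \<Sum>i. hcost s (U k i))"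
    by (rule suminf_ennreal_2dimen) simp
  also have "\<dots> \<le> (\<Sum>k. hausdorff_pre s \<delta> (E k) + ennreal (e * (1/2) ^ Suc k))"
    by (intro suminf_le less_imp_le U(4)) auto
  also have "\<dots> = (\<Sum>k. hausdorff_pre s \<delta> (E k)) + (\<Sum>k. ennreal (e * (1/2) ^ Suc k))"
    by (intro suminf_add[symmetric]) auto
  also have "(\<Sum>k. ennreal (e * (1/2) ^ Suc k)) = ennreal e"
  proof -
    have "(\<lambda>k. e * (1/2) ^ Suc k) sums (e * 1)"
      by (intro sums_mult power_half_series)
    then show ?thesis using e by (intro suminf_ennreal_eq) auto
  qed
  finally show "hausdorff_pre s \<delta> (\<Union>k. E k) \<le> (\<Sum>k. hausdorff_pre s \<delta> (E k)) + ennreal e" .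
qed

lemma hausdorff_measure_eq_0_iff:
  "hausdorff_measure s E = 0 \<longleftrightarrow> (\<forall>\<delta>>0. hausdorff_pre s \<delta> E = 0)"
  unfolding hausdorff_measure_def bot_ennreal[symmetric] by (auto simp: SUP_bot_conv)

lemma hausdorff_measure_eq_0_subset:
  assumes "hausdorff_measure s F = 0" "E \<subseteq> F" shows "hausdorff_measure s E = 0"
  using assms hausdorff_pre_mono[of E F s] unfolding hausdorff_measure_eq_0_iff
  by (metis le_zero_eq)

lemma hausdorff_measure_eq_0_UN:
  fixes E :: "nat \<Rightarrow> 'a::metric_space set"
  assumes "\<And>k. hausdorff_measure s (E k) = 0" shows "hausdorff_measure s (\<Union>k. E k) = 0"
  unfolding hausdorff_measure_eq_0_iff
proof safe
  fix \<delta> :: real assume "\<delta> > 0"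
  then have "hausdorff_pre s \<delta> (E k) = 0" for k
    using assms hausdorff_measure_eq_0_iff by blast
  then show "hausdorff_pre s \<delta> (\<Union>k. E k) = 0"
    using hausdorff_pre_UN[of s \<delta> E] by simp
qed

lemma hausdorff_pre_finite_cover:
  fixes X :: "'a::real_normed_vector set"
  assumes "finite X" "E \<subseteq> (\<Union>x\<in>X. cball x d)" "0 \<le> d" "2 * d \<le> \<delta>" "0 < s"
  shows "hausdorff_pre s \<delta> E \<le> ennreal (real (card X) * (2 * d) powr s)"
proof -
  obtain f where f: "bij_betw f {..<card X} X"
    using ex_bij_betw_nat_finite[OF assms(1)] by (auto simp: atLeast0LessThan)
  \<comment> \<open>Padding by empty sets, which cost nothing, turns the finite cover into a
    sequence.\<close>
  define U where "U i = (if i < card X then cball (f i) d else {})" for i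
  have dia: "diameter (U i) \<le> 2 * d" for i
  proof (cases "i < card X")
    case True
    have "diameter (cball (f i) d) \<le> 2 * d"
    proof (rule diameter_le)
      show "cball (f i) d \<noteq> {} \<or> 0 \<le> 2 * d" using assms(3) by simp
      show "norm (x - y) \<le> 2 * d" if "x \<in> cball (f i) d" "y \<in> cball (f i) d" for x y
        using that dist_triangle3[of x y "f i"] by (simp add: dist_norm)
    qed
    then show ?thesis using True by (simp add: U_def)
  qed (use assms(3) in \<open>simp add: U_def\<close>)
  have "hausdorff_pre s \<delta> E \<le> (\<Sum>i. hcost s (U i))"
  proof (rule hausdorff_pre_le)
    show "E \<subseteq> (\<Union>i. U i)"
    proof
      fix x assume "x \<in> E"
      then obtain y where y: "y \<in> X" "x \<in> cball y d" using assms(2) by blast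
      then obtain i where "i < card X" "f i = y" using f by (metis bij_betw_iff_bijections lessThan_iff)
      then have "x \<in> U i" using y by (simp add: U_def)
      then show "x \<in> (\<Union>i. U i)" by blast
    qed
    show "bounded (U i)" for i by (simp add: U_def)
    show "diameter (U i) \<le> \<delta>" for i using dia[of i] assms(4) by simp
  qed
  also have "\<dots> = (\<Sum>i<card X. hcost s (U i))"
    by (rule suminf_finite) (auto simp: U_def hcost_def)
  also have "\<dots> \<le> (\<Sum>i<card X. ennreal ((2 * d) powr s))"
  proof (rule sum_mono)
    fix i
    have "0 \<le> diameter (U i)" by (rule diameter_ge_0) (simp add: U_def)
    then show "hcost s (U i) \<le> ennreal ((2 * d) powr s)"
      unfolding hcost_eq using dia[of i] assms(5) by (intro ennreal_leI powr_mono2) auto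
  qed
  also have "\<dots> = ennreal (real (card X) * (2 * d) powr s)"
    by (simp add: ennreal_mult' ennreal_of_nat_eq_real_of_nat)
  finally show ?thesis .
qed

text \<open>A Borel-Cantelli argument: every tail of the \<open>B k\<close> covers E, at a cost
  bounded by a tail of a convergent series. The cost bound is only asked for eventually, since the
  covering discs get below size \<delta> only for large k.\<close>

lemma hausdorff_measure_limsup_eq_0:
  fixes B :: "nat \<Rightarrow> 'a::metric_space set"
  assumes lim: "\<And>k0. E \<subseteq> (\<Union>k\<in>{k0..}. B k)"
    and cov: "\<And>\<delta>. 0 < \<delta> \<Longrightarrow> eventually (\<lambda>k. hausdorff_pre s \<delta> (B k) \<le> ennreal (c k)) sequentially"
    and c: "summable c" "\<And>k. 0 \<le> c k"
  shows "hausdorff_measure s E = 0"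
  unfolding hausdorff_measure_eq_0_iff
proof safe
  fix \<delta> :: real assume "\<delta> > 0"
  from cov[OF this] obtain k1 where k1: "\<And>k. k \<ge> k1 \<Longrightarrow> hausdorff_pre s \<delta> (B k) \<le> ennreal (c k)"
    unfolding eventually_sequentially by blast
  have "hausdorff_pre s \<delta> E \<le> 0"
  proof (rule ennreal_le_epsilon)
    fix e :: real assume e: "0 < e"
    obtain k2 where k2: "\<And>n. n \<ge> k2 \<Longrightarrow> norm (\<Sum>i. c (i + n)) < e"
      using suminf_exist_split[OF e c(1)] by blast
    define k0 where "k0 = max k1 k2"
    have "E \<subseteq> (\<Union>k. B (k + k0))"
    proof
      fix x assume "x \<in> E"
      then obtain k where "k \<ge> k0" "x \<in> B k" using lim[of k0] by auto
      then have "x \<in> B ((k - k0) + k0)" by simp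
      then show "x \<in> (\<Union>k. B (k + k0))" by blast
    qed
    then have "hausdorff_pre s \<delta> E \<le> hausdorff_pre s \<delta> (\<Union>k. B (k + k0))"
      by (rule hausdorff_pre_mono)
    also have "\<dots> \<le> (\<Sum>k. hausdorff_pre s \<delta> (B (k + k0)))" by (rule hausdorff_pre_UN)
    also have "\<dots> \<le> (\<Sum>k. ennreal (c (k + k0)))"
      by (intro suminf_le k1) (auto simp: k0_def)
    also have "\<dots> = ennreal (\<Sum>k. c (k + k0))"
      using c summable_iff_shift[of c k0] by (intro suminf_ennreal2) auto
    also have "\<dots> \<le> ennreal e"
      using k2[of k0] by (intro ennreal_leI) (auto simp: k0_def)
    finally show "hausdorff_pre s \<delta> E \<le> 0 + ennreal e" by simp
  qed
  then show "hausdorff_pre s \<delta> E = 0" by simp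
qed

text \<open>A set of diameter D lies in a disc of radius D, whose area \<open>pi D^2\<close> is at
  most \<open>pi D^s\<close> because \<open>D \<le> 1\<close> and \<open>s \<le> 2\<close>.\<close>

lemma hausdorff_null_imp_negligible:
  fixes E :: "complex set"
  assumes "hausdorff_measure s E = 0" "0 < s" "s \<le> 2"
  shows "negligible E"
  unfolding negligible_outer_le
proof (intro allI impI)
  fix e :: real assume e: "e > 0"
  have "hausdorff_pre s 1 E < ennreal (e / pi)"
    using assms(1) e by (simp add: hausdorff_measure_eq_0_iff)
  then obtain U where U: "E \<subseteq> (\<Union>i. U i)" "\<And>i. bounded (U i)" "\<And>i. diameter (U i) \<le> 1"
    "(\<Sum>i. hcost s (U i)) < ennreal (e / pi)"
    by (rule hausdorff_pre_coverE) blast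
  define D where "D i = diameter (U i)" for i
  have D: "0 \<le> D i" "D i \<le> 1" for i using U by (auto simp: D_def diameter_ge_0)
  \<comment> \<open>If \<open>U i\<close> is empty the centre is arbitrary, but the radius is
    0.\<close>
  define V where "V i = cball (SOME x. x \<in> U i) (D i)" for i
  have UV: "U i \<subseteq> V i" for i
  proof
    fix x assume x: "x \<in> U i"
    then have "(SOME x. x \<in> U i) \<in> U i" by (rule someI)
    then show "x \<in> V i" using diameter_bounded_bound[OF U(2) _ x] by (simp add: V_def D_def)
  qed
  have hc: "hcost s (U i) = ennreal (D i powr s)" for i by (simp add: hcost_eq D_def)
  have eV: "emeasure lebesgue (V i) \<le> ennreal pi * hcost s (U i)" for i
  proof -
    have "emeasure lebesgue (V i) = ennreal (pi * D i ^ 2)"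
      using D[of i] by (simp add: V_def emeasure_cball unit_ball_vol_2)
    also have "D i ^ 2 \<le> D i powr s"
    proof (cases "D i = 0")
      case False
      then have "D i ^ 2 = D i powr 2" using D[of i] by simp
      also have "\<dots> \<le> D i powr s" using D[of i] False assms by (intro powr_mono') auto
      finally show ?thesis .
    qed auto
    then have "ennreal (pi * D i ^ 2) \<le> ennreal (pi * D i powr s)"
      by (intro ennreal_leI mult_left_mono) auto
    also have "\<dots> = ennreal pi * hcost s (U i)" by (simp add: hc ennreal_mult')
    finally show ?thesis by simp
  qed
  have Vm: "V i \<in> sets lebesgue" for i by (simp add: V_def)
  have "emeasure lebesgue (\<Union>i. V i) \<le> (\<Sum>i. emeasure lebesgue (V i))"
    by (rule emeasure_subadditive_countably) (use Vm in auto)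
  also have "\<dots> \<le> (\<Sum>i. ennreal pi * hcost s (U i))"
    by (intro suminf_le eV) auto
  also have "\<dots> = ennreal pi * (\<Sum>i. hcost s (U i))" by simp
  also have "\<dots> \<le> ennreal pi * ennreal (e / pi)"
    using U(4) by (intro mult_left_mono) auto
  also have "\<dots> = ennreal e" using e by (simp flip: ennreal_mult')
  finally have le: "emeasure lebesgue (\<Union>i. V i) \<le> ennreal e" .
  show "\<exists>T. E \<subseteq> T \<and> T \<in> lmeasurable \<and> measure lebesgue T \<le> e"
  proof (intro exI conjI)
    show "E \<subseteq> (\<Union>i. V i)" using U(1) UV by blast
    show "(\<Union>i. V i) \<in> lmeasurable"
      using le Vm by (intro fmeasurableI) (auto simp: le_less_trans[OF _ ennreal_less_top])
    show "measure lebesgue (\<Union>i. V i) \<le> e"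
      unfolding measure_def using le e by (simp add: enn2real_leI)
  qed
qed

section \<open>Derivatives of bounded power series\<close>

text \<open>The derivative of order i, divided by i!, of the partial sum of degree below m.\<close>
definition hasse :: "nat \<Rightarrow> nat \<Rightarrow> (nat \<Rightarrow> complex) \<Rightarrow> complex \<Rightarrow> complex" where
  "hasse m i a z = (\<Sum>k<m. a k * of_nat (k choose i) * z ^ (k - i))"

lemma hasse_0: "hasse m 0 a z = (\<Sum>k<m. a k * z ^ k)"
  by (simp add: hasse_def)

text \<open>The identity \<open>(k choose i) (i choose l) = (k choose l) (k - l choose i -
  l)\<close> turns the right side into the binomial expansion of \<open>(z + w) ^ (k - l)\<close>.
  For \<open>l > k\<close> the truncated subtraction is harmless because each term contains a
  vanishing binomial coefficient.\<close>

lemma binomial_taylor: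
  fixes z w :: complex
  assumes "k < m"
  shows "of_nat (k choose l) * (z + w) ^ (k - l)
    = (\<Sum>i<m. of_nat (i choose l) * (of_nat (k choose i) * z ^ (k - i)) * w ^ (i - l))"
proof (cases "l \<le> k")
  case False
  then have "(i choose l) = 0 \<or> (k choose i) = 0" for i
    by (cases "i < l") (auto simp: binomial_eq_0)
  then have "of_nat (i choose l) * (of_nat (k choose i) * z ^ (k - i)) * w ^ (i - l) = 0" for i
    by (metis mult_zero_left mult_zero_right of_nat_0)
  then have "(\<Sum>i<m. of_nat (i choose l) * (of_nat (k choose i) * z ^ (k - i)) * w ^ (i - l)) = 0"
    by (intro sum.neutral) blast
  then show ?thesis using False by (simp add: binomial_eq_0)
next
  case True
  have "(\<Sum>i<m. of_nat (i choose l) * (of_nat (k choose i) * z ^ (k - i)) * w ^ (i - l))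
      = (\<Sum>i\<in>{l..k}. of_nat (i choose l) * (of_nat (k choose i) * z ^ (k - i)) * w ^ (i - l))"
    using assms by (intro sum.mono_neutral_right) (auto simp: binomial_eq_0)
  also have "\<dots> = (\<Sum>j\<le>k - l. of_nat (j + l choose l) * (of_nat (k choose (j + l)) * z ^ (k - (j + l))) * w ^ j)"
    using True by (intro sum.reindex_bij_witness[of _ "\<lambda>j. j + l" "\<lambda>i. i - l"]) auto
  also have "\<dots> = (\<Sum>j\<le>k - l. of_nat (k choose l) * (of_nat ((k - l) choose j) * w ^ j * z ^ (k - l - j)))"
  proof (rule sum.cong[OF refl])
    fix j assume "j \<in> {..k - l}"
    then have j: "j + l \<le> k" using True by auto
    have "(k choose (j + l)) * (j + l choose l) = (k choose l) * ((k - l) choose j)"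
      using choose_mult[of l "j + l" k] j by simp
    then have "(of_nat (k choose (j + l)) * of_nat (j + l choose l) :: complex)
        = of_nat (k choose l) * of_nat ((k - l) choose j)"
      by (metis of_nat_mult)
    moreover have "k - (j + l) = k - l - j" by simp
    ultimately show "of_nat (j + l choose l) * (of_nat (k choose (j + l)) * z ^ (k - (j + l))) * w ^ j
      = of_nat (k choose l) * (of_nat ((k - l) choose j) * w ^ j * z ^ (k - l - j))"
      by (simp add: mult.assoc mult.left_commute mult.commute)
  qed
  also have "\<dots> = of_nat (k choose l) * (w + z) ^ (k - l)"
    by (simp add: binomial_ring sum_distrib_left)
  finally show ?thesis by (simp add: add.commute)
qed

lemma hasse_taylor:
  "hasse m l a (z + w) = (\<Sum>i<m. of_nat (i choose l) * hasse m i a z * w ^ (i - l))"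
proof -
  have "hasse m l a (z + w)
      = (\<Sum>k<m. \<Sum>i<m. a k * (of_nat (i choose l) * (of_nat (k choose i) * z ^ (k - i)) * w ^ (i - l)))"
    unfolding hasse_def by (intro sum.cong refl) (simp add: binomial_taylor mult.assoc sum_distrib_left)
  also have "\<dots> = (\<Sum>i<m. \<Sum>k<m. a k * (of_nat (i choose l) * (of_nat (k choose i) * z ^ (k - i)) * w ^ (i - l)))"
    by (rule sum.swap)
  also have "\<dots> = (\<Sum>i<m. of_nat (i choose l) * hasse m i a z * w ^ (i - l))"
    unfolding hasse_def sum_distrib_left sum_distrib_right
    by (intro sum.cong refl) (simp add: mult_ac)
  finally show ?thesis .
qed

text \<open>The right side is the sum of the full series, the divided derivative of
  \<open>1 / (1 - R)\<close>. Pascal's rule expresses the sum of order \<open>Suc i\<close> to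
  \<open>Suc n\<close> terms as R times the same sum to n terms plus the sum of order i;
  monotonicity in the number of terms closes the recursion.\<close>

lemma sum_binomial_power_le:
  fixes R :: real
  assumes "0 \<le> R" "R < 1"
  shows "(\<Sum>k<m. real (k choose i) * R ^ (k - i)) \<le> 1 / (1 - R) ^ Suc i"
proof (induction i arbitrary: m)
  case 0
  have "(\<Sum>k<m. R ^ k) = (1 - R ^ m) / (1 - R)"
    using assms by (simp add: sum_gp_strict)
  also have "\<dots> \<le> 1 / (1 - R)" using assms by (intro divide_right_mono) auto
  finally show ?case by simp
next
  case (Suc i)
  define S where "S m j = (\<Sum>k<m. real (k choose j) * R ^ (k - j))" for m j
  have "S (Suc n) (Suc i) = R * S n (Suc i) + S n i" for n
  proof -
    have "S (Suc n) (Suc i) = (\<Sum>k<n. real (Suc k choose Suc i) * R ^ (Suc k - Suc i))"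
      unfolding S_def by (subst sum.lessThan_Suc_shift) simp
    also have "\<dots> = (\<Sum>k<n. R * (real (k choose Suc i) * R ^ (k - Suc i)) + real (k choose i) * R ^ (k - i))"
    proof (rule sum.cong[OF refl])
      fix k
      have "real (k choose Suc i) * R ^ (k - i) = R * (real (k choose Suc i) * R ^ (k - Suc i))"
      proof (cases "Suc i \<le> k")
        case True
        then have "k - i = Suc (k - Suc i)" by simp
        then show ?thesis by simp
      qed (simp add: binomial_eq_0)
      then show "real (Suc k choose Suc i) * R ^ (Suc k - Suc i)
          = R * (real (k choose Suc i) * R ^ (k - Suc i)) + real (k choose i) * R ^ (k - i)"
        by (simp add: algebra_simps)
    qed
    finally show ?thesis by (simp add: S_def sum.distrib sum_distrib_left)
  qed
  moreover have "S n (Suc i) \<le> S (Suc n) (Suc i)" for n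
    unfolding S_def using assms by (intro sum_mono2) auto
  ultimately have "S n (Suc i) \<le> R * S n (Suc i) + S n i" for n by metis
  then have "S m (Suc i) * (1 - R) \<le> S m i" by (simp add: algebra_simps)
  also have "\<dots> \<le> 1 / (1 - R) ^ Suc i" using Suc unfolding S_def .
  finally have "S m (Suc i) \<le> 1 / (1 - R) ^ Suc i / (1 - R)"
    using assms by (subst pos_le_divide_eq) auto
  then show ?case by (simp add: S_def mult.commute)
qed

section \<open>Uniform bounds, truncation errors and Taylor remainders on a disc\<close>

lemma norm_hasse_le:
  assumes "\<And>k. norm (a k) \<le> 2" "norm z \<le> R" "R < 1"
  shows "norm (hasse m i a z) \<le> 2 / (1 - R) ^ Suc i"
proof -
  have R: "0 \<le> R" using assms(2) norm_ge_zero order_trans by blast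
  have "norm (hasse m i a z) \<le> (\<Sum>k<m. 2 * (real (k choose i) * R ^ (k - i)))"
    unfolding hasse_def
    using assms by (intro sum_norm_le) (auto simp: norm_mult norm_power mult.assoc intro!: mult_mono power_mono)
  also have "\<dots> = 2 * (\<Sum>k<m. real (k choose i) * R ^ (k - i))" by (simp add: sum_distrib_left)
  also have "\<dots> \<le> 2 * (1 / (1 - R) ^ Suc i)"
    using sum_binomial_power_le[OF R assms(3)] by (intro mult_left_mono) auto
  finally show ?thesis by simp
qed

text \<open>Since \<open>R^j = sqrt R^j sqrt R^j\<close>, one factor absorbs the polynomial and the
  other is summed.\<close>

lemma summable_power_mult_geometric:
  fixes R :: real
  assumes "0 < R" "R < 1"
  shows "summable (\<lambda>j. real (j + 1) ^ i * R ^ j)"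
proof (rule summable_comparison_test_ev)
  have "((\<lambda>j::nat. real (j + 1) ^ i * sqrt R ^ j) \<longlongrightarrow> 0) at_top"
    using assms by real_asymp
  then have "eventually (\<lambda>j. real (j + 1) ^ i * sqrt R ^ j < 1) sequentially"
    by (rule order_tendstoD) simp
  then show "eventually (\<lambda>j. norm (real (j + 1) ^ i * R ^ j) \<le> sqrt R ^ j) sequentially"
  proof eventually_elim
    case (elim j)
    have "R ^ j = sqrt R ^ j * sqrt R ^ j" using assms by (simp flip: power_mult_distrib)
    then have "norm (real (j + 1) ^ i * R ^ j) = (real (j + 1) ^ i * sqrt R ^ j) * sqrt R ^ j"
      using assms by (simp add: abs_mult)
    also have "\<dots> \<le> 1 * sqrt R ^ j" using elim assms by (intro mult_right_mono) auto
    finally show ?case by simp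
  qed
  show "summable ((^) (sqrt R))" using assms by (intro summable_geometric) auto
qed

text \<open>With the tail index written as \<open>k + j\<close>, the bound
  \<open>(k + j choose i) \<le> (k + 1)^i (j + 1)^i\<close> separates k from j, and the sum over j
  is a constant independent of a, z and m. The factor \<open>1 / R^i\<close> compensates for the
  exponent \<open>k + j - i\<close>.\<close>

lemma hasse_truncation:
  assumes "0 < R" "R < 1"
  obtains C where "0 < C" "\<And>a z k (m::nat). (\<And>k. norm (a k) \<le> 2) \<Longrightarrow> norm z \<le> R \<Longrightarrow> k \<le> m \<Longrightarrow>
     norm (hasse m i a z - hasse k i a z) \<le> C * real (k + 1) ^ i * R ^ k"
proof -
  define S where "S = (\<Sum>j. real (j + 1) ^ i * R ^ j)"
  have S: "(\<Sum>j<n. real (j + 1) ^ i * R ^ j) \<le> S" for n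
    unfolding S_def using summable_power_mult_geometric[OF assms] assms
    by (intro sum_le_suminf) auto
  have S0: "1 \<le> S" using S[of 1] by simp
  show ?thesis
  proof (rule that[of "2 * S / R ^ i"])
    show "0 < 2 * S / R ^ i" using S0 assms by simp
    fix a :: "nat \<Rightarrow> complex" and z :: complex and k m :: nat
    assume a: "\<And>k. norm (a k) \<le> 2" and z: "norm z \<le> R" and km: "k \<le> m"
    have "hasse m i a z - hasse k i a z = (\<Sum>l\<in>{k..<m}. a l * of_nat (l choose i) * z ^ (l - i))"
      unfolding hasse_def using km
      by (simp add: sum_diff_nat_ivl[of 0 k m, symmetric] lessThan_atLeast0)
    also have "\<dots> = (\<Sum>j<m - k. a (k + j) * of_nat (k + j choose i) * z ^ (k + j - i))"
      using km by (intro sum.reindex_bij_witness[of _ "\<lambda>j. k + j" "\<lambda>l. l - k"]) auto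
    also have "norm \<dots> \<le> (\<Sum>j<m - k. (2 / R ^ i * real (k + 1) ^ i * R ^ k) * (real (j + 1) ^ i * R ^ j))"
    proof (rule sum_norm_le)
      fix j
      show "norm (a (k + j) * of_nat (k + j choose i) * z ^ (k + j - i))
         \<le> (2 / R ^ i * real (k + 1) ^ i * R ^ k) * (real (j + 1) ^ i * R ^ j)"
      proof (cases "i \<le> k + j")
        case False
        then show ?thesis using assms by (simp add: binomial_eq_0)
      next
        case True
        have "(k + j choose i) \<le> (k + j) ^ i" by (rule binomial_le_pow[OF True])
        then have 1: "real (k + j choose i) \<le> real ((k + j) ^ i)" by (simp only: of_nat_le_iff)
        have "(k + j) ^ i \<le> ((k + 1) * (j + 1)) ^ i" by (intro power_mono) auto
        then have "real ((k + j) ^ i) \<le> real (((k + 1) * (j + 1)) ^ i)" by (simp only: of_nat_le_iff)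
        with 1 have 2: "real (k + j choose i) \<le> real (k + 1) ^ i * real (j + 1) ^ i"
          by (simp only: power_mult_distrib of_nat_mult of_nat_power)
        have 3: "R ^ (k + j - i) = R ^ k * R ^ j / R ^ i"
          using assms True by (simp add: power_diff power_add)
        have "norm (a (k + j) * of_nat (k + j choose i) * z ^ (k + j - i))
          \<le> 2 * (real (k + 1) ^ i * real (j + 1) ^ i) * R ^ (k + j - i)"
          unfolding norm_mult norm_power norm_of_nat
          using a z 2 assms by (intro mult_mono power_mono) auto
        then show ?thesis unfolding 3 by (simp add: mult_ac)
      qed
    qed
    also have "\<dots> = (2 / R ^ i * real (k + 1) ^ i * R ^ k) * (\<Sum>j<m - k. real (j + 1) ^ i * R ^ j)"
      by (simp add: sum_distrib_left)
    also have "\<dots> \<le> (2 / R ^ i * real (k + 1) ^ i * R ^ k) * S"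
      using assms by (intro mult_left_mono S) auto
    finally show "norm (hasse m i a z - hasse k i a z) \<le> 2 * S / R ^ i * real (k + 1) ^ i * R ^ k"
      by (simp add: mult_ac)
  qed
qed

text \<open>The radius \<open>(1 - R) / 8\<close> is chosen so that the factors \<open>2^i\<close>
  from the binomial coefficient, \<open>(1 - R)^-i\<close> from \<open>norm_hasse_le\<close> and
  \<open>norm w^i\<close> combine to ratio 1/4. Only \<open>p - l\<close> powers of w are kept as
  such; the other \<open>i - p\<close> are replaced by the radius.\<close>

lemma hasse_taylor_tail:
  assumes a: "\<And>k. norm (a k) \<le> 2" and z: "norm z \<le> R" and R: "0 < R" "R < 1"
    and w: "norm w \<le> (1 - R) / 8" and l: "l \<le> p"
  shows "norm (\<Sum>i\<in>{p..<m}. of_nat (i choose l) * hasse m i a z * w ^ (i - l))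
     \<le> norm w ^ (p - l) * (4 / ((1 - R) * ((1 - R) / 8) ^ p) * (1/4) ^ p)"
proof -
  define d where "d = (1 - R) / 8"
  have d: "0 < d" using R by (simp add: d_def)
  have "norm (\<Sum>i\<in>{p..<m}. of_nat (i choose l) * hasse m i a z * w ^ (i - l))
     \<le> (\<Sum>i\<in>{p..<m}. (norm w ^ (p - l) * (2 / ((1 - R) * d ^ p))) * (1/4) ^ i)"
  proof (rule sum_norm_le)
    fix i assume "i \<in> {p..<m}"
    then have i: "p \<le> i" by simp
    have "norm w ^ (i - l) = norm w ^ (p - l) * norm w ^ (i - p)"
      using i l by (simp flip: power_add)
    also have "\<dots> \<le> norm w ^ (p - l) * d ^ (i - p)"
      using w by (intro mult_left_mono power_mono) (auto simp: d_def)
    finally have 1: "norm w ^ (i - l) \<le> norm w ^ (p - l) * (d ^ i / d ^ p)"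
      using d i by (simp add: power_diff)
    have "real (i choose l) \<le> real (2 ^ i)" by (simp only: of_nat_le_iff binomial_le_pow2)
    then have 2: "real (i choose l) \<le> 2 ^ i" by simp
    have "norm (of_nat (i choose l) * hasse m i a z * w ^ (i - l))
        \<le> 2 ^ i * (2 / (1 - R) ^ Suc i) * (norm w ^ (p - l) * (d ^ i / d ^ p))"
      unfolding norm_mult norm_power norm_of_nat
      using 1 2 norm_hasse_le[OF a z R(2)] R d by (intro mult_mono) auto
    also have "\<dots> = (norm w ^ (p - l) * (2 / ((1 - R) * d ^ p))) * (2 * d / (1 - R)) ^ i"
      by (simp add: power_mult_distrib power_divide mult_ac)
    also have "2 * d / (1 - R) = 1/4" using R by (simp add: d_def)
    finally show "norm (of_nat (i choose l) * hasse m i a z * w ^ (i - l))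
        \<le> (norm w ^ (p - l) * (2 / ((1 - R) * d ^ p))) * (1/4) ^ i" .
  qed
  also have "\<dots> = (norm w ^ (p - l) * (2 / ((1 - R) * d ^ p))) * (\<Sum>i\<in>{p..<m}. (1/4) ^ i)"
    by (simp add: sum_distrib_left)
  also have "\<dots> \<le> (norm w ^ (p - l) * (2 / ((1 - R) * d ^ p))) * (2 * (1/4) ^ p)"
  proof (rule mult_left_mono)
    have "(\<Sum>i\<in>{p..<m}. (1/4) ^ i) \<le> (2 * (1/4) ^ p :: real)"
    proof (cases "p \<le> m")
      case True
      \<comment> \<open>The subtracted term makes the bound inductive.\<close>
      then have "(\<Sum>i\<in>{p..<m}. (1/4) ^ i) \<le> (2 * (1/4) ^ p - 2 * (1/4) ^ m :: real)"
      proof (induction m rule: dec_induct)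
        case (step n)
        have "(\<Sum>i\<in>{p..<Suc n}. (1/4) ^ i) = (\<Sum>i\<in>{p..<n}. (1/4) ^ i) + (1/4 :: real) ^ n"
          using step by simp
        moreover have "(0::real) \<le> (1/4) ^ n" "(1/4 :: real) ^ Suc n = (1/4) ^ n / 4" by simp_all
        ultimately show ?case using step.IH by linarith
      qed simp
      then show ?thesis using zero_le_power[of "1/4::real" m] by linarith
    qed simp
    then show "(\<Sum>i\<in>{p..<m}. (1/4) ^ i) \<le> (2 * (1/4) ^ p :: real)" .
  qed (use R d in auto)
  finally show ?thesis by (simp add: d_def mult_ac)
qed

text \<open>Taylor expansion to first order, with a constant uniform over coefficients and degree;
  the tail starting at order \<open>i + 2\<close> leaves two powers of
  \<open>z' - z\<close>.\<close>

lemma hasse_quadratic_error: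
  assumes R: "0 < R" "R < 1"
  obtains B where "0 < B"
    "\<And>(m::nat) a z z'. (\<And>k. norm (a k) \<le> 2) \<Longrightarrow> norm z \<le> R \<Longrightarrow> norm (z' - z) \<le> (1 - R) / 8 \<Longrightarrow>
      norm (hasse m i a z' - hasse m i a z - of_nat (Suc i) * hasse m (Suc i) a z * (z' - z))
        \<le> B * norm (z' - z) ^ 2"
proof
  define p where "p = i + 2"
  show "0 < 4 / ((1 - R) * ((1 - R) / 8) ^ p) * (1/4 :: real) ^ p" using R by simp
  fix m :: nat and a :: "nat \<Rightarrow> complex" and z z' :: complex
  assume a: "\<And>k. norm (a k :: complex) \<le> 2" and z: "norm z \<le> R" and w: "norm (z' - z) \<le> (1 - R) / 8"
  \<comment> \<open>This allows summation up to \<open>max m p\<close>, so that the first two Taylor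
    terms can be split off even for small m.\<close>
  have hz: "hasse m j a z = 0" if "j \<ge> m" for j
    using that by (simp add: hasse_def binomial_eq_0)
  let ?f = "\<lambda>j. of_nat (j choose i) * hasse m j a z * (z' - z) ^ (j - i)"
  have "hasse m i a z' = hasse m i a (z + (z' - z))" by simp
  also have "\<dots> = (\<Sum>j<m. ?f j)" by (rule hasse_taylor)
  also have "\<dots> = (\<Sum>j\<in>{i..<max m p}. ?f j)"
    by (rule sum.mono_neutral_cong) (auto simp: hz binomial_eq_0)
  also have "{i..<max m p} = insert i (insert (Suc i) {p..<max m p})" by (auto simp: p_def)
  also have "(\<Sum>j\<in>\<dots>. ?f j) = hasse m i a z + of_nat (Suc i) * hasse m (Suc i) a z * (z' - z) + (\<Sum>j\<in>{p..<max m p}. ?f j)"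
    by (simp add: p_def)
  also have "(\<Sum>j\<in>{p..<max m p}. ?f j) = (\<Sum>j\<in>{p..<m}. ?f j)"
    by (rule sum.mono_neutral_right) (auto simp: hz)
  finally have "hasse m i a z' - hasse m i a z - of_nat (Suc i) * hasse m (Suc i) a z * (z' - z) = (\<Sum>j\<in>{p..<m}. ?f j)"
    by simp
  moreover have "norm (\<Sum>j\<in>{p..<m}. ?f j)
      \<le> norm (z' - z) ^ (p - i) * (4 / ((1 - R) * ((1 - R) / 8) ^ p) * (1/4) ^ p)"
    by (rule hasse_taylor_tail[OF a z R w]) (simp add: p_def)
  moreover have "p - i = 2" by (simp add: p_def)
  ultimately show "norm (hasse m i a z' - hasse m i a z - of_nat (Suc i) * hasse m (Suc i) a z * (z' - z))
        \<le> 4 / ((1 - R) * ((1 - R) / 8) ^ p) * (1/4) ^ p * norm (z' - z) ^ 2"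
    by (simp add: mult.commute)
qed

text \<open>For points within \<open>c * \<tau>\<close> of each other the linear Taylor term is at
  least \<open>\<tau> x\<close>, with \<open>x = norm (z' - z)\<close>, and the choice
  \<open>c \<le> 1 / (2 * B)\<close> keeps the quadratic error below half of that. Hence
  \<open>\<tau> x \<le> 2 \<rho> + \<tau> x / 2\<close>. The conclusion is local: far apart, the
  same coefficients may have several near zeros.\<close>

lemma hasse_separation:
  assumes R: "0 < R" "R < 1"
  obtains c where "0 < c"
    "\<And>(m::nat) a z z' \<rho> \<tau>. (\<And>k. norm (a k) \<le> 2) \<Longrightarrow> norm z \<le> R \<Longrightarrow> 0 < \<tau> \<Longrightarrow> \<tau> \<le> 1 \<Longrightarrow>
      norm (z' - z) \<le> c * \<tau> \<Longrightarrow> norm (hasse m i a z) \<le> \<rho> \<Longrightarrow> norm (hasse m i a z') \<le> \<rho> \<Longrightarrow>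
      \<tau> \<le> norm (hasse m (Suc i) a z) \<Longrightarrow> norm (z' - z) \<le> 4 * \<rho> / \<tau>"
proof -
  obtain B where B: "0 < B"
    "\<And>(m::nat) a z z'. (\<And>k. norm (a k) \<le> 2) \<Longrightarrow> norm z \<le> R \<Longrightarrow> norm (z' - z) \<le> (1 - R) / 8 \<Longrightarrow>
      norm (hasse m i a z' - hasse m i a z - of_nat (Suc i) * hasse m (Suc i) a z * (z' - z))
        \<le> B * norm (z' - z) ^ 2"
    using hasse_quadratic_error[OF R] by blast
  define c where "c = min ((1 - R) / 8) (1 / (2 * B))"
  have c: "0 < c" using B R by (simp add: c_def)
  show ?thesis
  proof (rule that[OF c])
    fix m :: nat and a :: "nat \<Rightarrow> complex" and z z' :: complex and \<rho> \<tau> :: real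
    assume a: "\<And>k. norm (a k :: complex) \<le> 2" and z: "norm z \<le> R" and \<tau>: "0 < \<tau>" "\<tau> \<le> 1"
      and w: "norm (z' - z) \<le> c * \<tau>" and h: "norm (hasse m i a z) \<le> \<rho>" "norm (hasse m i a z') \<le> \<rho>"
      and h': "\<tau> \<le> norm (hasse m (Suc i) a z)"
    define x where "x = norm (z' - z)"
    have "c * \<tau> \<le> c * 1" using c \<tau> by (intro mult_left_mono) auto
    then have x1: "x \<le> (1 - R) / 8" using w by (simp add: x_def c_def)
    have "c * \<tau> \<le> 1 / (2 * B) * \<tau>" using \<tau> by (intro mult_right_mono) (auto simp: c_def)
    then have "x \<le> \<tau> / (2 * B)" using w by (simp add: x_def)
    then have "B * x \<le> \<tau> / 2" using B by (simp add: field_simps)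
    then have x2: "B * x ^ 2 \<le> \<tau> / 2 * x"
      unfolding power2_eq_square mult.assoc[symmetric] by (rule mult_right_mono) (simp add: x_def)
    have "\<tau> * x \<le> 1 * norm (hasse m (Suc i) a z) * x"
      using h' by (intro mult_right_mono) (auto simp: x_def)
    also have "\<dots> \<le> real (Suc i) * norm (hasse m (Suc i) a z) * x"
      by (intro mult_right_mono) (auto simp: x_def)
    also have "\<dots> = norm (of_nat (Suc i) * hasse m (Suc i) a z * (z' - z))"
      by (simp only: norm_mult norm_of_nat x_def)
    also have "\<dots> \<le> norm (hasse m i a z' - hasse m i a z)
        + norm (hasse m i a z' - hasse m i a z - of_nat (Suc i) * hasse m (Suc i) a z * (z' - z))"
      using norm_triangle_ineq4[of "hasse m i a z' - hasse m i a z"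
        "hasse m i a z' - hasse m i a z - of_nat (Suc i) * hasse m (Suc i) a z * (z' - z)"]
      by (simp only: diff_diff_eq2 add_diff_cancel_left' diff_add_cancel) simp
    also have "\<dots> \<le> (\<rho> + \<rho>) + B * x ^ 2"
      using B(2)[OF a z, of z' m] x1 norm_triangle_ineq4[of "hasse m i a z'" "hasse m i a z"] h
      by (intro add_mono) (auto simp: x_def)
    also have "\<dots> \<le> 2 * \<rho> + \<tau> / 2 * x" using x2 by simp
    finally have "\<tau> * x \<le> 4 * \<rho>" by simp
    then show "norm (z' - z) \<le> 4 * \<rho> / \<tau>" using \<tau> by (simp add: x_def field_simps)
  qed
qed

text \<open>If all low derivatives are tiny at z, they are tiny on a disc of fixed radius about z, by the
  Taylor expansion; finitely many such discs lead from z to 0, where the value is a 0.\<close>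
lemma hasse_nondegenerate:
  assumes R: "0 < R" "R < 1"
  obtains J c where "0 < c"
    "\<And>(m::nat) a z. 0 < m \<Longrightarrow> (\<And>k. norm (a k) \<le> 2) \<Longrightarrow> 2 \<le> norm (a 0) \<Longrightarrow> norm z \<le> R \<Longrightarrow>
      \<exists>i\<le>J. c \<le> norm (hasse m i a z)"
proof -
  define d where "d = (1 - R) / 8"
  have d: "0 < d" "d \<le> 1/2" using R by (auto simp: d_def)
  have *: "\<exists>J c. 0 < c \<and> (\<forall>m a z. 0 < m \<longrightarrow> (\<forall>k. norm (a k) \<le> 2) \<longrightarrow> 2 \<le> norm (a 0) \<longrightarrow>
      norm z \<le> R \<longrightarrow> norm z \<le> real n * d \<longrightarrow> (\<exists>i\<le>J. c \<le> norm (hasse m i a z)))" for n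
  proof (induction n)
    case 0
    have "hasse m 0 a 0 = a 0" if "0 < m" for m a
    proof -
      have "(\<Sum>k<m. a k * 0 ^ k) = (\<Sum>k\<in>{0}. a k * 0 ^ k)"
        using that by (intro sum.mono_neutral_right) auto
      then show ?thesis by (simp add: hasse_0)
    qed
    then show ?case by (intro exI[of _ 0] exI[of _ 2]) auto
  next
    case (Suc n)
    then obtain J c where c: "0 < c" and IH: "\<And>m a z. 0 < m \<Longrightarrow> (\<And>k. norm (a k) \<le> 2) \<Longrightarrow> 2 \<le> norm (a 0) \<Longrightarrow>
      norm z \<le> R \<Longrightarrow> norm z \<le> real n * d \<Longrightarrow> \<exists>i\<le>J. c \<le> norm (hasse m i a z)" by blast
    have "(\<lambda>p. 4 / ((1 - R) * d ^ J) * (1/4) ^ p) \<longlonglongrightarrow> 4 / ((1 - R) * d ^ J) * 0"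
      by (intro tendsto_mult tendsto_const LIMSEQ_power_zero) auto
    then have "eventually (\<lambda>p. 4 / ((1 - R) * d ^ J) * (1/4) ^ p < c / 2) sequentially"
      using c by (intro order_tendstoD(2)[where y = "4 / ((1 - R) * d ^ J) * 0"]) auto
    then obtain p0 where p0: "\<And>p. p \<ge> p0 \<Longrightarrow> 4 / ((1 - R) * d ^ J) * (1/4) ^ p < c / 2"
      unfolding eventually_sequentially by blast
    \<comment> \<open>Orders from p on contribute less than \<open>c / 2\<close> to the Taylor
      expansion at \<open>z + w\<close>, whatever the coefficients are.\<close>
    define p where "p = max p0 (Suc J)"
    \<comment> \<open>If all orders below p were smaller than \<open>c'\<close>, their contribution
      would be at most \<open>c' / (1 - d) ^ Suc l \<le> c' * 2 ^ Suc J = c / 2\<close>.\<close>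
    define c' where "c' = c / 2 / 2 ^ Suc J"
    have c': "0 < c'" using c by (simp add: c'_def)
    show ?case
    proof (rule exI[of _ p], rule exI[of _ c'], intro conjI c' allI impI)
      fix m :: nat and a :: "nat \<Rightarrow> complex" and z :: complex
      assume m: "0 < m" and a: "\<forall>k. norm (a k :: complex) \<le> 2" and a0: "2 \<le> norm (a 0)"
        and z: "norm z \<le> R" and zn: "norm z \<le> real (Suc n) * d"
      \<comment> \<open>A radial step towards 0 of length at most d, bringing z into the disc of
        radius \<open>n * d\<close> where the induction hypothesis applies.\<close>
      define w where "w = - z / of_nat (Suc n)"
      have w: "norm w \<le> d"
        using zn by (simp add: w_def norm_divide field_simps del: of_nat_Suc)
      have zw: "z + w = z * of_real (real n / real (Suc n))"
      proof -
        have ne: "of_nat (Suc n) \<noteq> (0::complex)" by (simp del: of_nat_Suc)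
        have "z + w = (z * of_nat (Suc n) - z) / of_nat (Suc n)"
          unfolding w_def using ne by (simp add: diff_divide_distrib del: of_nat_Suc)
        also have "z * of_nat (Suc n) - z = z * of_nat n" by (simp add: algebra_simps)
        finally show ?thesis by (simp only: of_real_divide of_real_of_nat_eq times_divide_eq_right)
      qed
      have nzw: "norm (z + w) = norm z * (real n / real (Suc n))"
        unfolding zw norm_mult norm_of_real by simp
      have "norm (z + w) \<le> norm z * 1" unfolding nzw by (intro mult_left_mono) auto
      moreover have "norm (z + w) \<le> real (Suc n) * d * (real n / real (Suc n))"
        unfolding nzw using zn by (intro mult_right_mono) auto
      ultimately have "norm (z + w) \<le> R" "norm (z + w) \<le> real n * d" using z by (auto simp: mult.commute)
      with IH[OF m, of a "z + w"] a a0 obtain l where l: "l \<le> J" "c \<le> norm (hasse m l a (z + w))" by blast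
      show "\<exists>i\<le>p. c' \<le> norm (hasse m i a z)"
      proof (rule ccontr)
        assume "\<not> ?thesis"
        then have small: "norm (hasse m i a z) < c'" if "i \<le> p" for i using that by force
        let ?f = "\<lambda>j. of_nat (j choose l) * hasse m j a z * w ^ (j - l)"
        have hz: "hasse m j a z = 0" if "j \<ge> m" for j
          using that by (simp add: hasse_def binomial_eq_0)
        have "hasse m l a (z + w) = (\<Sum>j<m. ?f j)" by (rule hasse_taylor)
        also have "\<dots> = (\<Sum>j<max m p. ?f j)" by (rule sum.mono_neutral_left) (auto simp: hz)
        also have "{..<max m p} = {..<p} \<union> {p..<max m p}" by auto
        also have "(\<Sum>j\<in>\<dots>. ?f j) = (\<Sum>j<p. ?f j) + (\<Sum>j\<in>{p..<max m p}. ?f j)"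
          by (rule sum.union_disjoint) auto
        also have "(\<Sum>j\<in>{p..<max m p}. ?f j) = (\<Sum>j\<in>{p..<m}. ?f j)"
          by (rule sum.mono_neutral_right) (auto simp: hz)
        finally have "norm (hasse m l a (z + w)) \<le> norm (\<Sum>j<p. ?f j) + norm (\<Sum>j\<in>{p..<m}. ?f j)"
          by (simp add: norm_triangle_ineq)
        moreover have "norm (\<Sum>j\<in>{p..<m}. ?f j) < c / 2"
        proof -
          have "norm (\<Sum>j\<in>{p..<m}. ?f j) \<le> norm w ^ (p - l) * (4 / ((1 - R) * d ^ p) * (1/4) ^ p)"
            unfolding d_def using a z R w l by (intro hasse_taylor_tail) (auto simp: d_def p_def)
          also have "\<dots> \<le> d ^ (p - l) * (4 / ((1 - R) * d ^ p) * (1/4) ^ p)"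
            using w d R by (intro mult_right_mono power_mono) auto
          also have "\<dots> = 4 / ((1 - R) * d ^ l) * (1/4) ^ p"
            using d l by (simp add: power_diff p_def)
          also have "\<dots> \<le> 4 / ((1 - R) * d ^ J) * (1/4) ^ p"
            using d R l by (intro mult_right_mono divide_left_mono mult_left_mono power_decreasing) auto
          also have "\<dots> < c / 2" by (rule p0) (simp add: p_def)
          finally show ?thesis .
        qed
        moreover have "norm (\<Sum>j<p. ?f j) \<le> c / 2"
        proof -
          have "norm (\<Sum>j<p. ?f j) \<le> (\<Sum>j<p. c' * (real (j choose l) * d ^ (j - l)))"
          proof (rule sum_norm_le)
            fix j assume "j \<in> {..<p}"
            then have "norm (hasse m j a z) \<le> c'" using small[of j] by simp
            then have "norm (?f j) \<le> real (j choose l) * c' * d ^ (j - l)"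
              unfolding norm_mult norm_power norm_of_nat using w c'
              by (intro mult_mono power_mono) auto
            then show "norm (?f j) \<le> c' * (real (j choose l) * d ^ (j - l))" by (simp add: mult_ac)
          qed
          also have "\<dots> = c' * (\<Sum>j<p. real (j choose l) * d ^ (j - l))" by (simp add: sum_distrib_left)
          also have "\<dots> \<le> c' * (1 / (1 - d) ^ Suc l)"
            using c' d by (intro mult_left_mono sum_binomial_power_le) auto
          also have "\<dots> \<le> c' * 2 ^ Suc J"
          proof (rule mult_left_mono)
            have "1 / (1 - d) ^ Suc l = (1 / (1 - d)) ^ Suc l" by (simp add: power_divide)
            also have "\<dots> \<le> 2 ^ Suc l"
              using d by (intro power_mono) (auto simp: field_simps)
            also have "\<dots> \<le> 2 ^ Suc J" using l by (intro power_increasing) auto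
            finally show "1 / (1 - d) ^ Suc l \<le> 2 ^ Suc J" .
          qed (use c' in simp)
          also have "c' * 2 ^ Suc J = c / 2" by (simp add: c'_def)
          finally show ?thesis .
        qed
        ultimately show False using l(2) by linarith
      qed
    qed
  qed
  obtain n where "R / d \<le> real n" using real_arch_simple by blast
  then have n: "R \<le> real n * d" using d by (simp add: field_simps)
  from *[of n] obtain J c where "0 < c" and
    J: "\<forall>m a z. 0 < m \<longrightarrow> (\<forall>k. norm (a k) \<le> 2) \<longrightarrow> 2 \<le> norm (a 0) \<longrightarrow>
      norm z \<le> R \<longrightarrow> norm z \<le> real n * d \<longrightarrow> (\<exists>i\<le>J. c \<le> norm (hasse m i a z))" by blast
  show ?thesis
  proof (rule that[OF \<open>0 < c\<close>])
    fix m :: nat and a :: "nat \<Rightarrow> complex" and z :: complex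
    assume m: "0 < m" and a: "\<And>k. norm (a k) \<le> 2" and a0: "2 \<le> norm (a 0)" and z: "norm z \<le> R"
    show "\<exists>i\<le>J. c \<le> norm (hasse m i a z)"
      by (rule J[rule_format, of m a z]) (use m a a0 z n in auto)
  qed
qed

section \<open>Words and counting\<close>

definition words :: "nat \<Rightarrow> int list set" where
  "words m = {w. set w \<subseteq> {-1, 1} \<and> length w = m}"

definition wsum :: "complex \<Rightarrow> int list \<Rightarrow> complex" where
  "wsum z w = (\<Sum>k<length w. of_int (w ! k) * z ^ k)"

text \<open>Extended by 0 to a full sequence, since the estimates for \<open>hasse\<close> ask for
  \<open>norm (a k) \<le> 2\<close> at every index.\<close>

definition wdiff :: "int list \<Rightarrow> int list \<Rightarrow> nat \<Rightarrow> complex" where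
  "wdiff u v k = (if k < length u \<and> k < length v then of_int (u ! k - v ! k) else 0)"

text \<open>For \<open>K \<ge> 0\<close> the diagonal alone gives \<open>2^m\<close> pairs, so a
  growth of \<open>2^(m(1 + \<epsilon>))\<close> is minimal up to \<epsilon>.\<close>

definition close_pairs :: "real \<Rightarrow> complex \<Rightarrow> nat \<Rightarrow> (int list \<times> int list) set" where
  "close_pairs K z m = {(u, v) \<in> words m \<times> words m. norm (wsum z u - wsum z v) \<le> K * norm z ^ m}"

section \<open>Elementary facts about words\<close>

lemma finite_words [simp]: "finite (words m)"
  unfolding words_def by (rule finite_lists_length_eq) simp

lemma card_words: "card (words m) = 2 ^ m"
  unfolding words_def by (subst card_lists_length_eq) (auto simp: numeral_2_eq_2)

lemma length_words: "w \<in> words m \<Longrightarrow> length w = m"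
  by (simp add: words_def)

lemma words_nth: "w \<in> words m \<Longrightarrow> k < m \<Longrightarrow> w ! k = -1 \<or> w ! k = 1"
  unfolding words_def using nth_mem[of k w] by blast

lemma take_words: "w \<in> words m \<Longrightarrow> k \<le> m \<Longrightarrow> take k w \<in> words k"
  unfolding words_def by (auto dest: in_set_takeD)

lemma drop_words: "w \<in> words m \<Longrightarrow> drop k w \<in> words (m - k)"
  unfolding words_def by (auto dest: in_set_dropD)

lemma finite_close_pairs [simp]: "finite (close_pairs K z m)"
  unfolding close_pairs_def by (rule finite_subset[of _ "words m \<times> words m"]) auto

lemma sum_lessThan_add:
  fixes f :: "nat \<Rightarrow> 'a::comm_monoid_add"
  shows "(\<Sum>k<a + b. f k) = (\<Sum>k<a. f k) + (\<Sum>k<b. f (a + k))"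
  by (induction b) (simp_all add: add.assoc)

lemma wsum_append: "wsum z (u @ v) = wsum z u + z ^ length u * wsum z v"
proof -
  have "wsum z (u @ v) = (\<Sum>k<length u. of_int ((u @ v) ! k) * z ^ k)
      + (\<Sum>k<length v. of_int ((u @ v) ! (length u + k)) * z ^ (length u + k))"
    unfolding wsum_def length_append by (rule sum_lessThan_add)
  then show ?thesis by (simp add: wsum_def nth_append power_add sum_distrib_left mult_ac)
qed

lemma norm_wdiff_le:
  assumes "u \<in> words m" "v \<in> words m" shows "norm (wdiff u v k) \<le> 2"
  using words_nth[OF assms(1), of k] words_nth[OF assms(2), of k] length_words[OF assms(1)]
  by (auto simp: wdiff_def)

lemma norm_wdiff_0:
  assumes "u \<in> words m" "v \<in> words m" "0 < m" "hd u \<noteq> hd v" shows "2 \<le> norm (wdiff u v 0)"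
proof -
  have "u ! 0 \<noteq> v ! 0" using assms length_words by (metis hd_conv_nth length_greater_0_conv)
  then show ?thesis
    using words_nth[OF assms(1), of 0] words_nth[OF assms(2), of 0] length_words assms
    by (auto simp: wdiff_def)
qed

lemma hasse_0_wdiff:
  assumes "u \<in> words m" "v \<in> words m"
  shows "hasse m 0 (wdiff u v) z = wsum z u - wsum z v"
  using length_words[OF assms(1)] length_words[OF assms(2)]
  unfolding hasse_0 wsum_def wdiff_def
  by (simp add: sum_subtractf[symmetric] algebra_simps)

text \<open>Makes the conditions on truncated derivatives conditions on prefixes, which can be
  counted.\<close>

lemma hasse_wdiff_take:
  assumes "u \<in> words m" "v \<in> words m" "k \<le> m"
  shows "hasse k i (wdiff (take k u) (take k v)) z = hasse k i (wdiff u v) z"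
  using length_words[OF assms(1)] length_words[OF assms(2)] assms(3)
  unfolding hasse_def wdiff_def by (intro sum.cong) auto

text \<open>With n c the size of the fibre of g over c, the left side is the sum of
  \<open>n c * n (\<phi> c)\<close>. By \<open>2ab \<le> a^2 + b^2\<close> and injectivity of \<phi>
  it is at most the sum of \<open>n c ^ 2\<close>: an autocorrelation is largest at shift
  zero.\<close>

lemma card_shifted_coincidences_le:
  fixes g :: "'a \<Rightarrow> 'b"
  assumes S: "finite S" and inj: "inj \<phi>"
  shows "card {(u, v) \<in> S \<times> S. \<phi> (g u) = g v} \<le> card {(u, v) \<in> S \<times> S. g u = g v}"
proof -
  define n where "n c = card {u \<in> S. g u = c}" for c
  have *: "card {(u, v) \<in> S \<times> S. \<psi> (g u) = g v} = (\<Sum>c\<in>g ` S. n c * n (\<psi> c))" for \<psi> :: "'b \<Rightarrow> 'b"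
  proof -
    have "{(u, v) \<in> S \<times> S. \<psi> (g u) = g v} = (\<Union>c\<in>g ` S. {u \<in> S. g u = c} \<times> {u \<in> S. g u = \<psi> c})"
      by auto
    also have "card \<dots> = (\<Sum>c\<in>g ` S. card ({u \<in> S. g u = c} \<times> {u \<in> S. g u = \<psi> c}))"
      using S by (intro card_UN_disjoint) auto
    finally show ?thesis by (simp add: n_def card_cartesian_product)
  qed
  have n0: "n c = 0" if "c \<notin> g ` S" for c
    using that by (auto simp: n_def card_eq_0_iff)
  have "(\<Sum>c\<in>g ` S. n (\<phi> c) ^ 2) = (\<Sum>c\<in>\<phi> ` g ` S. n c ^ 2)"
    using inj by (subst sum.reindex) (auto simp: inj_on_def)
  also have "\<dots> = (\<Sum>c\<in>(\<phi> ` g ` S) \<inter> (g ` S). n c ^ 2)"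
    using S by (intro sum.mono_neutral_right) (auto simp: n0)
  also have "\<dots> \<le> (\<Sum>c\<in>g ` S. n c ^ 2)"
    using S by (intro sum_mono2) auto
  finally have 1: "(\<Sum>c\<in>g ` S. n (\<phi> c) ^ 2) \<le> (\<Sum>c\<in>g ` S. n c ^ 2)" .
  have amgm: "2 * (a * b) \<le> a ^ 2 + b ^ 2" for a b :: nat
  proof -
    have "0 \<le> (int a - int b) ^ 2" by simp
    then have "int (2 * (a * b)) \<le> int (a ^ 2 + b ^ 2)" by (simp add: power2_eq_square algebra_simps)
    then show ?thesis by (simp only: of_nat_le_iff)
  qed
  have "2 * (\<Sum>c\<in>g ` S. n c * n (\<phi> c)) \<le> (\<Sum>c\<in>g ` S. n c ^ 2 + n (\<phi> c) ^ 2)"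
    unfolding sum_distrib_left by (rule sum_mono) (rule amgm)
  also have "\<dots> \<le> 2 * (\<Sum>c\<in>g ` S. n c ^ 2)" using 1 by (simp add: sum.distrib)
  finally have "(\<Sum>c\<in>g ` S. n c * n (\<phi> c)) \<le> (\<Sum>c\<in>g ` S. n c * n (id c))"
    by (simp add: power2_eq_square)
  then show ?thesis using *[of \<phi>] *[of id] by simp
qed

text \<open>The index of a grid square of side \<open>\<rho> / 2\<close>, small enough that two
  points of one square are within \<rho>.\<close>

definition cell :: "real \<Rightarrow> complex \<Rightarrow> int \<times> int" where
  "cell \<rho> z = (\<lfloor>2 * Re z / \<rho>\<rfloor>, \<lfloor>2 * Im z / \<rho>\<rfloor>)"

lemma cell_eq_imp_close:
  assumes "cell \<rho> z = cell \<rho> w" "0 < \<rho>" shows "norm (z - w) \<le> \<rho>"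
proof -
  have *: "\<bar>x - y\<bar> \<le> \<rho> / 2" if "\<lfloor>2 * x / \<rho>\<rfloor> = \<lfloor>2 * y / \<rho>\<rfloor>" for x y :: real
  proof -
    have "\<bar>2 * x / \<rho> - 2 * y / \<rho>\<bar> \<le> 1" using that by linarith
    moreover have "2 * x / \<rho> - 2 * y / \<rho> = 2 / \<rho> * (x - y)"
      by (simp add: diff_divide_distrib algebra_simps)
    moreover have "\<bar>2 / \<rho> * (x - y)\<bar> = 2 / \<rho> * \<bar>x - y\<bar>" using assms(2) by (simp only: abs_mult) simp
    ultimately have "2 / \<rho> * \<bar>x - y\<bar> \<le> 1" by simp
    then show ?thesis using assms(2) by (simp add: field_simps)
  qed
  have "norm (z - w) \<le> \<bar>Re (z - w)\<bar> + \<bar>Im (z - w)\<bar>" by (rule cmod_le)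
  also have "\<dots> \<le> \<rho> / 2 + \<rho> / 2"
    using assms(1) *[of "Re z" "Re w"] *[of "Im z" "Im w"] by (intro add_mono) (auto simp: cell_def)
  finally show ?thesis by simp
qed

text \<open>Six possible values per coordinate; their square is the constant 36 of the next
  lemma.\<close>

lemma floor_shift_bounds:
  fixes a b y :: real
  assumes "\<bar>y + a - b\<bar> \<le> 2"
  shows "\<lfloor>b\<rfloor> - \<lfloor>a\<rfloor> \<in> {\<lfloor>y\<rfloor> - 2..\<lfloor>y\<rfloor> + 3}"
proof -
  have "a + y - 2 \<le> b" "b \<le> a + y + 2" using assms by linarith+
  then have "\<lfloor>a + y - 2\<rfloor> \<le> \<lfloor>b\<rfloor>" "\<lfloor>b\<rfloor> \<le> \<lfloor>a + y + 2\<rfloor>" by (simp_all only: floor_mono)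
  moreover have "\<lfloor>a + y - 2\<rfloor> = \<lfloor>a + y\<rfloor> - 2" "\<lfloor>a + y + 2\<rfloor> = \<lfloor>a + y\<rfloor> + 2" by linarith+
  moreover have "\<lfloor>a\<rfloor> + \<lfloor>y\<rfloor> \<le> \<lfloor>a + y\<rfloor>" "\<lfloor>a + y\<rfloor> \<le> \<lfloor>a\<rfloor> + \<lfloor>y\<rfloor> + 1" by linarith+
  ultimately show ?thesis by simp
qed

text \<open>If \<open>x + f u\<close> and \<open>f v\<close> are close, the cell indices of
  \<open>f u\<close> and \<open>f v\<close> differ by one of 36 shifts depending only on x. Each
  shift occurs at most as often as the zero shift, and points in the same cell are close.\<close>

lemma card_translated_close_le:
  fixes f :: "'a \<Rightarrow> complex"
  assumes S: "finite S" and \<rho>: "0 < \<rho>"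
  shows "card {(u, v) \<in> S \<times> S. norm (x + f u - f v) \<le> \<rho>}
     \<le> 36 * card {(u, v) \<in> S \<times> S. norm (f u - f v) \<le> \<rho>}"
proof -
  define q where "q u = cell \<rho> (f u)" for u
  define D where "D = {\<lfloor>2 * Re x / \<rho>\<rfloor> - 2..\<lfloor>2 * Re x / \<rho>\<rfloor> + 3} \<times> {\<lfloor>2 * Im x / \<rho>\<rfloor> - 2..\<lfloor>2 * Im x / \<rho>\<rfloor> + 3}"
  have cD: "card D = 36" by (simp add: D_def card_cartesian_product)
  have fin: "finite {(u, v) \<in> S \<times> S. P u v}" for P
    by (rule finite_subset[of _ "S \<times> S"]) (use S in auto)
  have cov: "{(u, v) \<in> S \<times> S. norm (x + f u - f v) \<le> \<rho>} \<subseteq> (\<Union>d\<in>D. {(u, v) \<in> S \<times> S. q u + d = q v})"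
  proof safe
    fix u v assume uv: "u \<in> S" "v \<in> S" and n: "norm (x + f u - f v) \<le> \<rho>"
    have scale: "\<bar>2 * s / \<rho> + 2 * t / \<rho> - 2 * r / \<rho>\<bar> \<le> 2" if "\<bar>s + t - r\<bar> \<le> \<rho>" for s t r :: real
    proof -
      have "2 * s / \<rho> + 2 * t / \<rho> - 2 * r / \<rho> = 2 * ((s + t - r) / \<rho>)"
        by (simp add: add_divide_distrib diff_divide_distrib algebra_simps)
      moreover have "\<bar>(s + t - r) / \<rho>\<bar> \<le> 1" using that \<rho> by (simp add: abs_divide)
      ultimately show ?thesis by (simp only: abs_mult)
    qed
    have "\<bar>Re x + Re (f u) - Re (f v)\<bar> \<le> \<rho>" "\<bar>Im x + Im (f u) - Im (f v)\<bar> \<le> \<rho>"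
      using abs_Re_le_cmod[of "x + f u - f v"] abs_Im_le_cmod[of "x + f u - f v"] n by auto
    then have "q v - q u \<in> D"
      using floor_shift_bounds[OF scale] by (auto simp: q_def cell_def D_def minus_prod_def)
    moreover have "q u + (q v - q u) = q v" by simp
    ultimately show "(u, v) \<in> (\<Union>d\<in>D. {(u, v) \<in> S \<times> S. q u + d = q v})" using uv by blast
  qed
  have "card {(u, v) \<in> S \<times> S. norm (x + f u - f v) \<le> \<rho>} \<le> card (\<Union>d\<in>D. {(u, v) \<in> S \<times> S. q u + d = q v})"
    using cov by (intro card_mono finite_UN_I fin) (auto simp: D_def)
  also have "\<dots> \<le> (\<Sum>d\<in>D. card {(u, v) \<in> S \<times> S. q u + d = q v})"
    by (rule card_UN_le) (simp add: D_def)
  also have "\<dots> \<le> (\<Sum>d\<in>D. card {(u, v) \<in> S \<times> S. q u = q v})"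
    by (intro sum_mono card_shifted_coincidences_le[OF S]) (simp add: inj_def)
  also have "\<dots> = 36 * card {(u, v) \<in> S \<times> S. q u = q v}" by (simp add: cD)
  also have "\<dots> \<le> 36 * card {(u, v) \<in> S \<times> S. norm (f u - f v) \<le> \<rho>}"
    using cell_eq_imp_close[OF _ \<rho>] by (intro mult_left_mono card_mono fin) (auto simp: q_def)
  finally show ?thesis .
qed

text \<open>Each cell of side \<open>\<sigma> / 2\<close> holds at most one point, and each
  coordinate of the index takes at most \<open>4 / \<sigma> + 2 \<le> 6 / \<sigma>\<close>
  values.\<close>

lemma card_separated_le:
  fixes X :: "complex set"
  assumes X: "finite X" "X \<subseteq> cball 0 1" and \<sigma>: "0 < \<sigma>" "\<sigma> \<le> 1"
    and sep: "\<And>x y. x \<in> X \<Longrightarrow> y \<in> X \<Longrightarrow> x \<noteq> y \<Longrightarrow> \<sigma> < norm (x - y)"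
  shows "real (card X) \<le> 36 / \<sigma> ^ 2"
proof -
  define I where "I = {\<lfloor>- (2 / \<sigma>)\<rfloor>..\<lfloor>2 / \<sigma>\<rfloor>}"
  have inj: "inj_on (cell \<sigma>) X"
    by (rule inj_onI) (use sep cell_eq_imp_close[OF _ \<sigma>(1)] in force)
  have *: "\<lfloor>2 * t / \<sigma>\<rfloor> \<in> I" if "\<bar>t\<bar> \<le> 1" for t
  proof -
    have "- (2 / \<sigma>) \<le> 2 * t / \<sigma>" "2 * t / \<sigma> \<le> 2 / \<sigma>"
      using that \<sigma> by (auto simp: field_simps)
    then show ?thesis unfolding I_def by (auto intro: floor_mono)
  qed
  have "cell \<sigma> ` X \<subseteq> I \<times> I"
  proof
    fix c assume "c \<in> cell \<sigma> ` X"
    then obtain x where x: "x \<in> X" "c = cell \<sigma> x" by blast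
    then have "norm x \<le> 1" using X by auto
    then have "\<bar>Re x\<bar> \<le> 1" "\<bar>Im x\<bar> \<le> 1"
      using abs_Re_le_cmod[of x] abs_Im_le_cmod[of x] by auto
    then show "c \<in> I \<times> I" using x * by (auto simp: cell_def)
  qed
  then have "card X \<le> card (I \<times> I)"
    using card_mono[of "I \<times> I" "cell \<sigma> ` X"] card_image[OF inj] by (simp add: I_def)
  then have "real (card X) \<le> real (card I) * real (card I)"
    by (metis card_cartesian_product of_nat_le_iff of_nat_mult)
  also have "real (card I) \<le> 6 / \<sigma>"
  proof -
    have "0 \<le> 2 / \<sigma>" using \<sigma> by simp
    then have "0 \<le> \<lfloor>2 / \<sigma>\<rfloor> - \<lfloor>- (2 / \<sigma>)\<rfloor> + 1" by linarith
    then have "real (card I) = of_int (\<lfloor>2 / \<sigma>\<rfloor> - \<lfloor>- (2 / \<sigma>)\<rfloor> + 1)"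
      unfolding I_def card_atLeastAtMost_int by (subst of_nat_nat) auto
    also have "\<dots> \<le> 4 / \<sigma> + 2" by linarith
    also have "\<dots> \<le> 6 / \<sigma>" using \<sigma> by (simp add: field_simps)
    finally show ?thesis .
  qed
  then have "real (card I) * real (card I) \<le> 6 / \<sigma> * (6 / \<sigma>)"
    by (intro mult_mono) (use \<sigma> in auto)
  finally show ?thesis by (simp add: power2_eq_square)
qed

text \<open>A maximal set of points of B more than \<delta> apart is counted against the elements of P: each p
  belongs to T z only for points z that are more than \<sigma> apart.\<close>
lemma cover_by_multiplicity:
  fixes B :: "complex set" and T :: "complex \<Rightarrow> 'p set"
  assumes P: "finite P" and B: "B \<subseteq> cball 0 1" and T: "\<And>z. z \<in> B \<Longrightarrow> T z \<subseteq> P"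
    and L: "0 < L" "\<And>z. z \<in> B \<Longrightarrow> L \<le> real (card (T z))" and \<sigma>: "0 < \<sigma>" "\<sigma> \<le> 1"
    and sep: "\<And>p z z'. z \<in> B \<Longrightarrow> z' \<in> B \<Longrightarrow> p \<in> T z \<Longrightarrow> p \<in> T z' \<Longrightarrow> norm (z - z') \<le> \<sigma> \<Longrightarrow> norm (z - z') \<le> \<delta>"
  obtains X where "finite X" "B \<subseteq> (\<Union>x\<in>X. cball x \<delta>)" "real (card X) \<le> real (card P) * 36 / (\<sigma> ^ 2 * L)"
proof (cases "B = {}")
  case True
  then show ?thesis using L by (intro that[of "{}"]) auto
next
  case False
  define sepd where "sepd X \<longleftrightarrow> finite X \<and> X \<subseteq> B \<and> (\<forall>x\<in>X. \<forall>y\<in>X. x \<noteq> y \<longrightarrow> \<delta> < norm (x - y))" for X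
  have bound: "real (card X) \<le> real (card P) * 36 / (\<sigma> ^ 2 * L)" if X: "sepd X" for X
  proof -
    have fX: "finite X" and XB: "X \<subseteq> B" using X by (auto simp: sepd_def)
    have "L * real (card X) = (\<Sum>x\<in>X. L)" by simp
    also have "\<dots> \<le> (\<Sum>x\<in>X. real (card (T x)))" using XB L(2) by (intro sum_mono) auto
    also have "\<dots> = (\<Sum>x\<in>X. \<Sum>p\<in>P. if p \<in> T x then 1 else 0)"
    proof (rule sum.cong[OF refl])
      fix x assume "x \<in> X"
      then have "P \<inter> T x = T x" using T XB by blast
      then show "real (card (T x)) = (\<Sum>p\<in>P. if p \<in> T x then 1 else 0)"
        using P by (simp add: sum.If_cases Int_def Collect_mem_eq)
    qed
    also have "\<dots> = (\<Sum>p\<in>P. \<Sum>x\<in>X. if p \<in> T x then 1 else 0)" by (rule sum.swap)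
    also have "\<dots> = (\<Sum>p\<in>P. real (card {x \<in> X. p \<in> T x}))"
      using fX by (simp add: sum.If_cases Int_def)
    also have "\<dots> \<le> (\<Sum>p\<in>P. 36 / \<sigma> ^ 2)"
    proof (rule sum_mono, rule card_separated_le[OF _ _ \<sigma>])
      fix p
      show "finite {x \<in> X. p \<in> T x}" using fX by simp
      show "{x \<in> X. p \<in> T x} \<subseteq> cball 0 1" using XB B by blast
      fix x y assume xy: "x \<in> {x \<in> X. p \<in> T x}" "y \<in> {x \<in> X. p \<in> T x}" "x \<noteq> y"
      then have "\<delta> < norm (x - y)" using X by (auto simp: sepd_def)
      \<comment> \<open>Contraposition of \<open>sep\<close>: two points sharing p are within
        \<delta> or more than \<sigma> apart, and within X the first is impossible.\<close>
      then show "\<sigma> < norm (x - y)" using sep[of x y p] xy XB by force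
    qed
    also have "\<dots> = real (card P) * 36 / \<sigma> ^ 2" by simp
    finally have "real (card X) \<le> real (card P) * 36 / \<sigma> ^ 2 / L"
      using L(1) by (subst pos_le_divide_eq) (simp_all add: mult.commute)
    then show ?thesis by simp
  qed
  have "\<exists>X. sepd X \<and> (\<forall>Y. sepd Y \<longrightarrow> card Y \<le> card X)"
  proof (rule ex_has_greatest_nat)
    show "sepd {}" by (simp add: sepd_def)
    show "\<forall>Y. sepd Y \<longrightarrow> card Y < Suc (nat \<lceil>real (card P) * 36 / (\<sigma> ^ 2 * L)\<rceil>)"
    proof (intro allI impI)
      fix Y assume "sepd Y"
      then have "real (card Y) \<le> real (nat \<lceil>real (card P) * 36 / (\<sigma> ^ 2 * L)\<rceil>)"
        using bound real_nat_ceiling_ge order_trans by blast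
      then show "card Y < Suc (nat \<lceil>real (card P) * 36 / (\<sigma> ^ 2 * L)\<rceil>)"
        by (simp only: of_nat_le_iff less_Suc_eq_le)
    qed
  qed
  then obtain X where X: "sepd X" "\<And>Y. sepd Y \<Longrightarrow> card Y \<le> card X" by blast
  \<comment> \<open>Positivity of L makes \<open>T z\<close> nonempty, and then \<open>sep\<close>
    compares z with itself. Consequently a point outside all balls around X is not in X.\<close>
  have "0 \<le> \<delta>"
  proof -
    obtain z where z: "z \<in> B" using False by blast
    then have "0 < real (card (T z))" using L by fastforce
    then have "T z \<noteq> {}" by auto
    then obtain p where "p \<in> T z" by blast
    then show ?thesis using sep[OF z z] \<sigma> by simp
  qed
  show ?thesis
  proof (rule that)
    show "finite X" using X(1) by (simp add: sepd_def)
    show "real (card X) \<le> real (card P) * 36 / (\<sigma> ^ 2 * L)" by (rule bound[OF X(1)])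
    show "B \<subseteq> (\<Union>x\<in>X. cball x \<delta>)"
    proof (rule ccontr)
      assume "\<not> ?thesis"
      then obtain z where "z \<in> B" "z \<notin> (\<Union>x\<in>X. cball x \<delta>)" by blast
      then have z: "z \<in> B" "\<And>x. x \<in> X \<Longrightarrow> \<delta> < norm (x - z)"
        by (auto simp: dist_norm not_le)
      then have "z \<notin> X" using \<open>0 \<le> \<delta>\<close> by force
      moreover have "sepd (insert z X)"
        using X(1) z by (auto simp: sepd_def norm_minus_commute)
      ultimately show False using X(2)[of "insert z X"] X(1) by (simp add: sepd_def)
    qed
  qed
qed

text \<open>The first index whose value exceeds the maximum over \<open>{..m0}\<close> is a record,
  and it lies beyond \<open>m0\<close>.\<close>

lemma ex_record:
  fixes f :: "nat \<Rightarrow> real"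
  assumes "\<And>A. \<exists>m. A < f m"
  obtains m where "m0 \<le> m" "\<And>n. n \<le> m \<Longrightarrow> f n \<le> f m"
proof -
  define A where "A = Max (f ` {..m0})"
  define m where "m = (LEAST m. A < f m)"
  have m: "A < f m" unfolding m_def using assms[of A] by (rule LeastI_ex)
  have less: "f n \<le> A" if "n < m" for n
    using not_less_Least[of n "\<lambda>m. A < f m"] that by (simp add: m_def not_less)
  have "f n \<le> A" if "n \<le> m0" for n using that by (simp add: A_def)
  then have "m0 \<le> m" using m by (metis linorder_not_le nle_le)
  moreover have "f n \<le> f m" if "n \<le> m" for n
    using less[of n] m that by (cases "n = m") auto
  ultimately show ?thesis by (rule that)
qed

section \<open>The dimension of the attractor\<close>

lemma summable_sign_series:
  fixes z :: complex
  assumes "\<And>n. norm (a n) \<le> 1" "norm z < 1"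
  shows "summable (\<lambda>n. a n * z ^ n)"
proof (rule summable_comparison_test')
  show "summable (\<lambda>n. norm z ^ n)" using assms(2) by (intro summable_geometric) auto
  show "norm (a n * z ^ n) \<le> norm z ^ n" if "n \<ge> 0" for n
    using assms(1)[of n] by (simp add: norm_mult norm_power mult_left_le_one_le)
qed

lemma map_sign_words:
  assumes "\<And>n. a n \<in> {-1, 1::int}" shows "map a [0..<k] \<in> words k"
  using assms by (auto simp: words_def)

lemma wsum_map: "wsum z (map a [0..<k]) = (\<Sum>n<k. of_int (a n) * z ^ n)"
  by (simp add: wsum_def)

lemma norm_sign_tail_le:
  fixes z :: complex
  assumes a: "\<And>n. a n \<in> {-1, 1::int}" and z: "norm z < 1"
  shows "norm ((\<Sum>n. of_int (a n) * z ^ n) - wsum z (map a [0..<k])) \<le> norm z ^ k / (1 - norm z)"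
proof -
  have n1: "norm (of_int (a n) :: complex) \<le> 1" for n using a[of n] by auto
  have sm: "summable (\<lambda>n. of_int (a n) * z ^ n)" by (rule summable_sign_series[OF n1 z])
  have "(\<Sum>n. of_int (a n) * z ^ n) - wsum z (map a [0..<k]) = (\<Sum>n. of_int (a (n + k)) * z ^ (n + k))"
    unfolding wsum_map using suminf_split_initial_segment[OF sm, of k] by simp
  also have "norm \<dots> \<le> (\<Sum>n. norm z ^ k * norm z ^ n)"
  proof (rule norm_suminf_le)
    show "norm (of_int (a (n + k)) * z ^ (n + k)) \<le> norm z ^ k * norm z ^ n" for n
      unfolding norm_mult norm_power power_add using n1[of "n + k"]
      by (simp add: mult_left_le_one_le mult.commute)
    show "summable (\<lambda>n. norm z ^ k * norm z ^ n)"
      using z by (intro summable_mult summable_geometric) auto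
  qed
  also have "\<dots> = norm z ^ k / (1 - norm z)"
    using z by (simp add: suminf_mult summable_geometric suminf_geometric)
  finally show ?thesis .
qed

text \<open>A continuous image of the Cantor space \<open>{-1, 1}^nat\<close>. Compactness later
  reduces an open cover of the attractor to a finite one.\<close>

lemma compact_A_set:
  assumes z: "norm z < 1" shows "compact (A_set z)"
proof -
  define P where "P = (PiE UNIV (\<lambda>_. {-1, 1}) :: (nat \<Rightarrow> complex) set)"
  have "compactin (product_topology (\<lambda>_::nat. euclidean :: complex topology) UNIV) P"
    unfolding P_def by (subst compactin_PiE) auto
  then have cP: "compact P" by (simp add: euclidean_product_topology)
  have cont: "continuous_on P (\<lambda>a. \<Sum>n. a n * z ^ n)"
  proof (rule uniform_limit_theorem)
    show "\<forall>\<^sub>F n in sequentially. continuous_on P (\<lambda>a. \<Sum>i<n. a i * z ^ i)"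
      by (intro always_eventually allI continuous_intros continuous_on_product_coordinates
            continuous_on_subset[OF continuous_on_product_coordinates]) auto
    show "uniform_limit P (\<lambda>n a. \<Sum>i<n. a i * z ^ i) (\<lambda>a. \<Sum>n. a n * z ^ n) sequentially"
    proof (rule Weierstrass_m_test)
      show "summable (\<lambda>n. norm z ^ n)" using z by (intro summable_geometric) auto
      show "norm (a n * z ^ n) \<le> norm z ^ n" if "a \<in> P" for n a
      proof -
        have "a n \<in> {-1, 1}" using that by (auto simp: P_def PiE_def)
        then have "norm (a n) = 1" by auto
        then show ?thesis by (simp add: norm_mult norm_power)
      qed
    qed
  qed auto
  have "A_set z = (\<lambda>a. \<Sum>n. a n * z ^ n) ` P"
  proof safe
    fix x assume "x \<in> A_set z"
    then obtain a :: "nat \<Rightarrow> int" where a: "\<And>n. a n \<in> {-1, 1}" "x = (\<Sum>n. of_int (a n) * z ^ n)"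
      unfolding A_set_def by blast
    have "of_int (a n) \<in> {-1, 1 :: complex}" for n using a(1)[of n] by auto
    then have "(\<lambda>n. of_int (a n)) \<in> P" by (simp add: P_def PiE_iff)
    then show "x \<in> (\<lambda>a. \<Sum>n. a n * z ^ n) ` P" 
      using a(2) by (intro image_eqI[where x = "\<lambda>n. of_int (a n)"]) auto
  next
    fix a assume "a \<in> P"
    then have a: "a n = -1 \<or> a n = 1" for n by (auto simp: P_def PiE_def Pi_def)
    define b :: "nat \<Rightarrow> int" where "b n = (if a n = 1 then 1 else -1)" for n
    have "of_int (b n) = a n" for n using a[of n] by (auto simp: b_def)
    moreover have "\<forall>n. b n \<in> {-1, 1}" by (simp add: b_def)
    ultimately show "(\<Sum>n. a n * z ^ n) \<in> A_set z"
      unfolding A_set_def by (intro CollectI exI[of _ b]) simp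
  qed
  then show ?thesis using compact_continuous_image[OF cont cP] by simp
qed

text \<open>The \<open>2^k\<close> discs of radius \<open>\<rho>^k / (1 - \<rho>)\<close> around the
  word sums cost a constant times \<open>(2 \<rho>^t)^k\<close>, and \<open>2 \<rho>^t < 1\<close>
  says exactly that t exceeds \<open>sim_dim z\<close>. The limsup lemma is used with a constant
  family.\<close>

lemma hausdorff_measure_A_set_eq_0:
  assumes z: "0 < norm z" "norm z < 1" and t: "sim_dim z < t"
  shows "hausdorff_measure t (A_set z) = 0"
proof -
  define \<rho> where "\<rho> = norm z"
  have \<rho>: "0 < \<rho>" "\<rho> < 1" using z by (auto simp: \<rho>_def)
  have lnr: "ln \<rho> < 0" using \<rho> by simp
  have t0: "0 < t"
  proof -
    have "0 < sim_dim z" unfolding sim_dim_def using lnr by (intro divide_pos_pos) (auto simp: \<rho>_def)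
    then show ?thesis using t by simp
  qed
  have "ln 2 < t * (- ln \<rho>)"
    using t lnr unfolding sim_dim_def \<rho>_def[symmetric] by (subst (asm) pos_divide_less_eq) auto
  then have "ln (2 * \<rho> powr t) < ln 1" using \<rho> by (simp add: ln_mult ln_powr)
  then have q1: "2 * \<rho> powr t < 1" using \<rho> by (subst (asm) ln_less_cancel_iff) auto
  define c where "c k = (2 / (1 - \<rho>)) powr t * (2 * \<rho> powr t) ^ k" for k
  have ceq: "2 ^ k * (2 * (\<rho> ^ k / (1 - \<rho>))) powr t = c k" for k
  proof -
    have "(2 * (\<rho> ^ k / (1 - \<rho>))) powr t = (2 / (1 - \<rho>) * \<rho> ^ k) powr t" by simp
    also have "\<dots> = (2 / (1 - \<rho>)) powr t * (\<rho> ^ k) powr t" using \<rho> by (intro powr_mult)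
    also have "(\<rho> ^ k) powr t = (\<rho> powr t) ^ k"
      using \<rho> by (simp flip: powr_realpow add: powr_powr mult.commute)
    finally show ?thesis by (simp add: c_def power_mult_distrib)
  qed
  show ?thesis
  proof (rule hausdorff_measure_limsup_eq_0[where B = "\<lambda>_. A_set z" and c = c])
    show "summable c" unfolding c_def using q1 by (intro summable_mult summable_geometric) auto
    show "0 \<le> c k" for k by (simp add: c_def)
    show "A_set z \<subseteq> (\<Union>k\<in>{k0..}. A_set z)" for k0 :: nat by auto
    fix \<delta> :: real assume "0 < \<delta>"
    moreover have "(\<lambda>k. 2 * (\<rho> ^ k / (1 - \<rho>))) \<longlonglongrightarrow> 2 * (0 / (1 - \<rho>))"
      using \<rho> by (intro tendsto_intros LIMSEQ_power_zero) auto
    ultimately have "\<forall>\<^sub>F k in sequentially. 2 * (\<rho> ^ k / (1 - \<rho>)) < \<delta>"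
      by (intro order_tendstoD) auto
    then show "\<forall>\<^sub>F k in sequentially. hausdorff_pre t \<delta> (A_set z) \<le> ennreal (c k)"
    proof eventually_elim
      case (elim k)
      have cX: "card (wsum z ` words k) \<le> 2 ^ k" using card_image_le[of "words k" "wsum z"] by (simp add: card_words)
      have "hausdorff_pre t \<delta> (A_set z) \<le> ennreal (real (card (wsum z ` words k)) * (2 * (\<rho> ^ k / (1 - \<rho>))) powr t)"
      proof (rule hausdorff_pre_finite_cover)
        show "A_set z \<subseteq> (\<Union>x\<in>wsum z ` words k. cball x (\<rho> ^ k / (1 - \<rho>)))"
        proof
          fix x assume "x \<in> A_set z"
          then obtain a :: "nat \<Rightarrow> int" where a: "\<And>n. a n \<in> {-1, 1}" "x = (\<Sum>n. of_int (a n) * z ^ n)"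
            unfolding A_set_def by blast
          have "x \<in> cball (wsum z (map a [0..<k])) (\<rho> ^ k / (1 - \<rho>))"
            using norm_sign_tail_le[of a z k, OF a(1) z(2)] a(2)
            by (simp add: \<rho>_def dist_norm norm_minus_commute)
          then show "x \<in> (\<Union>x\<in>wsum z ` words k. cball x (\<rho> ^ k / (1 - \<rho>)))"
            using map_sign_words[of a k, OF a(1)] by blast
        qed
      qed (use elim \<rho> t0 in auto)
      also have "\<dots> \<le> ennreal (2 ^ k * (2 * (\<rho> ^ k / (1 - \<rho>))) powr t)"
      proof (intro ennreal_leI mult_right_mono)
        have "real (card (wsum z ` words k)) \<le> real (2 ^ k)" using cX by (simp only: of_nat_le_iff)
        then show "real (card (wsum z ` words k)) \<le> 2 ^ k" by simp
      qed auto
      finally show ?case unfolding ceq .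
    qed
  qed
qed

section \<open>Lower bound for the dimension by mass distribution on words\<close>

lemma card_take_in_le:
  assumes "n \<le> M" "B \<subseteq> words n"
  shows "card {u \<in> words M. take n u \<in> B} \<le> card B * 2 ^ (M - n)"
proof -
  have "inj_on (\<lambda>u. (take n u, drop n u)) {u \<in> words M. take n u \<in> B}"
    by (rule inj_onI) (metis append_take_drop_id prod.inject)
  moreover have "(\<lambda>u. (take n u, drop n u)) ` {u \<in> words M. take n u \<in> B} \<subseteq> B \<times> words (M - n)"
    using drop_words by auto
  moreover have "finite (B \<times> words (M - n))" using finite_subset[OF assms(2)] by auto
  ultimately have "card {u \<in> words M. take n u \<in> B} \<le> card (B \<times> words (M - n))"
    by (rule card_inj_on_le)
  then show ?thesis by (simp add: card_cartesian_product card_words)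
qed

text \<open>Markov's inequality at each level: because
  \<open>2^(1 + \<epsilon>) = (2 \<rho>^t) (2g)\<close>, words of length n with too many neighbours
  form a share of at most \<open>(1 - g) / 2 * g^n\<close> of all words. The shares sum to at most
  1/2, so half of the words of length M are good at all levels at once.\<close>

lemma many_regular_words:
  fixes z :: complex
  defines "\<rho> \<equiv> norm z"
  assumes z: "0 < norm z" and A: "\<And>m. real (card (close_pairs K z m)) \<le> A * 2 powr (real m * (1 + \<epsilon>))"
    and t: "2 powr (\<epsilon> - 1) < \<rho> powr t" and A0: "0 < A"
  obtains A' where "0 < A'"
    "\<And>M. 2 ^ M / 2 \<le> real (card {u \<in> words M. \<forall>n\<le>M.
      real (card {w \<in> words n. norm (wsum z (take n u) - wsum z w) \<le> K * \<rho> ^ n}) \<le> A' * (2 * \<rho> powr t) ^ n})"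
proof -
  define g where "g = 2 powr (\<epsilon> - 1) / \<rho> powr t"
  have pt: "0 < \<rho> powr t" using z by (simp add: \<rho>_def)
  have g: "0 < g" "g < 1" using t pt by (auto simp: g_def)
  \<comment> \<open>Normalised against the geometric series of ratio g.\<close>
  define A' where "A' = 2 * A / (1 - g)"
  have A': "0 < A'" using A0 g by (simp add: A'_def)
  define c where "c n v = real (card {w \<in> words n. norm (wsum z v - wsum z w) \<le> K * \<rho> ^ n})" for n v
  define Bad where "Bad n = {v \<in> words n. A' * (2 * \<rho> powr t) ^ n < c n v}" for n
  have fB: "finite (Bad n)" "Bad n \<subseteq> words n" for n by (auto simp: Bad_def)
  have cB: "real (card (Bad n)) \<le> (1 - g) / 2 * (2 * g) ^ n" for n
  proof -
    have "A' * (2 * \<rho> powr t) ^ n * real (card (Bad n)) = (\<Sum>v\<in>Bad n. A' * (2 * \<rho> powr t) ^ n)" by simp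
    also have "\<dots> \<le> (\<Sum>v\<in>Bad n. c n v)" by (intro sum_mono) (auto simp: Bad_def)
    also have "\<dots> \<le> (\<Sum>v\<in>words n. c n v)" by (intro sum_mono2 fB) (auto simp: c_def)
    also have "\<dots> = real (card (SIGMA v:words n. {w \<in> words n. norm (wsum z v - wsum z w) \<le> K * \<rho> ^ n}))"
      by (simp add: c_def)
    also have "(SIGMA v:words n. {w \<in> words n. norm (wsum z v - wsum z w) \<le> K * \<rho> ^ n}) = close_pairs K z n"
      by (auto simp: close_pairs_def \<rho>_def)
    also have "real (card (close_pairs K z n)) \<le> A * 2 powr (real n * (1 + \<epsilon>))" by (rule A)
    also have "2 powr (real n * (1 + \<epsilon>)) = (2 * \<rho> powr t) ^ n * (2 * g) ^ n"
    proof -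
      have "2 powr (real n * (1 + \<epsilon>)) = (2 powr (1 + \<epsilon>)) ^ n"
        by (simp add: powr_powr mult.commute flip: powr_realpow)
      also have "2 powr (1 + \<epsilon>) = 2 powr (2 + (\<epsilon> - 1))" by simp
      also have "\<dots> = 2 powr 2 * 2 powr (\<epsilon> - 1)" by (simp only: powr_add)
      also have "\<dots> = (2 * \<rho> powr t) * (2 * g)" using pt by (simp add: g_def)
      finally show ?thesis by (simp only: power_mult_distrib)
    qed
    finally have "(real (card (Bad n)) * A') * (2 * \<rho> powr t) ^ n \<le> (A * (2 * g) ^ n) * (2 * \<rho> powr t) ^ n"
      by (simp only: mult_ac)
    then have "real (card (Bad n)) * A' \<le> A * (2 * g) ^ n"
      by (rule mult_right_le_imp_le) (use pt in simp)
    then have "real (card (Bad n)) \<le> A * (2 * g) ^ n / A'" using A' by (simp add: pos_le_divide_eq)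
    also have "\<dots> = (1 - g) / 2 * (2 * g) ^ n" using A0 g by (simp add: A'_def)
    finally show ?thesis .
  qed
  show ?thesis
  proof (rule that[OF A'])
    fix M
    define G where "G = {u \<in> words M. \<forall>n\<le>M. c n (take n u) \<le> A' * (2 * \<rho> powr t) ^ n}"
    have fG: "finite G" by (simp add: G_def)
    have sub: "words M \<subseteq> G \<union> (\<Union>n\<le>M. {u \<in> words M. take n u \<in> Bad n})"
      using take_words by (fastforce simp: G_def Bad_def not_le)
    have "2 ^ M = real (card (words M))" by (simp add: card_words)
    also have "\<dots> \<le> real (card G + card (\<Union>n\<le>M. {u \<in> words M. take n u \<in> Bad n}))"
      using card_mono[OF _ sub] fG card_Un_le[of G "\<Union>n\<le>M. {u \<in> words M. take n u \<in> Bad n}"]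
      by (simp only: of_nat_le_iff) (auto intro: order_trans)
    finally have "2 ^ M \<le> real (card G + card (\<Union>n\<le>M. {u \<in> words M. take n u \<in> Bad n}))" .
    moreover have "real (card (\<Union>n\<le>M. {u \<in> words M. take n u \<in> Bad n})) \<le> 2 ^ M / 2"
    proof -
      have "card (\<Union>n\<le>M. {u \<in> words M. take n u \<in> Bad n}) \<le> (\<Sum>n\<le>M. card {u \<in> words M. take n u \<in> Bad n})"
        by (rule card_UN_le) simp
      also have "\<dots> \<le> (\<Sum>n\<le>M. card (Bad n) * 2 ^ (M - n))"
        by (intro sum_mono card_take_in_le fB) auto
      finally have "real (card (\<Union>n\<le>M. {u \<in> words M. take n u \<in> Bad n})) \<le> real (\<Sum>n\<le>M. card (Bad n) * 2 ^ (M - n))"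
        by (simp only: of_nat_le_iff)
      also have "\<dots> = (\<Sum>n\<le>M. real (card (Bad n)) * 2 ^ (M - n))" by simp
      also have "\<dots> \<le> (\<Sum>n\<le>M. ((1 - g) / 2 * 2 ^ M) * g ^ n)"
      proof (rule sum_mono)
        fix n assume "n \<in> {..M}"
        then have eq: "(2::real) ^ n * 2 ^ (M - n) = 2 ^ M" by (simp flip: power_add)
        have "real (card (Bad n)) * 2 ^ (M - n) \<le> (1 - g) / 2 * (2 * g) ^ n * 2 ^ (M - n)"
          by (intro mult_right_mono cB) simp
        also have "\<dots> = ((1 - g) / 2 * (2 ^ n * 2 ^ (M - n))) * g ^ n" by (simp add: power_mult_distrib mult_ac)
        finally show "real (card (Bad n)) * 2 ^ (M - n) \<le> ((1 - g) / 2 * 2 ^ M) * g ^ n" unfolding eq .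
      qed
      also have "\<dots> = ((1 - g) / 2 * 2 ^ M) * (\<Sum>n\<le>M. g ^ n)" by (simp add: sum_distrib_left)
      also have "\<dots> = ((1 - g) * (\<Sum>n\<le>M. g ^ n)) * (2 ^ M / 2)" by simp
      also have "\<dots> = (1 - g ^ Suc M) * (2 ^ M / 2)" by (simp only: sum_gp_basic)
      also have "\<dots> \<le> 1 * (2 ^ M / 2)" using g by (intro mult_right_mono) auto
      finally show ?thesis by simp
    qed
    ultimately have "2 ^ M / 2 \<le> real (card G)" by simp
    then show "2 ^ M / 2 \<le> real (card {u \<in> words M. \<forall>n\<le>M.
      real (card {w \<in> words n. norm (wsum z (take n u) - wsum z w) \<le> K * \<rho> ^ n}) \<le> A' * (2 * \<rho> powr t) ^ n})"
      by (simp add: G_def c_def)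
  qed
qed

text \<open>Compactness needs open sets, and comparison with powers of \<rho> needs positive sizes,
  whereas the sets of a cover may be closed or single points. Since \<open>powr t\<close> is right
  continuous, slightly larger sizes cost at most e more in total; diameters at most 1/2 leave room
  for \<open>d i \<le> 1\<close>.\<close>

lemma thickened_cover:
  fixes U :: "nat \<Rightarrow> 'a::metric_space set"
  assumes U: "\<And>i. bounded (U i)" "\<And>i. diameter (U i) \<le> 1/2" and t: "0 < t" and e: "0 < e"
    and s: "(\<Sum>i. hcost t (U i)) < ennreal e"
  obtains V d where "\<And>i. open (V i)" "\<And>i. U i \<subseteq> V i" "\<And>i. 0 < d i" "\<And>i. d i \<le> 1"
    "\<And>i x y. x \<in> V i \<Longrightarrow> y \<in> V i \<Longrightarrow> dist x y \<le> d i"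
    "\<And>I. finite I \<Longrightarrow> (\<Sum>i\<in>I. d i powr t) \<le> 2 * e"
proof -
  define D where "D i = diameter (U i)" for i
  have D: "0 \<le> D i" "D i \<le> 1/2" for i using U by (auto simp: D_def diameter_ge_0)
  have "\<exists>d. D i < d \<and> d \<le> 1 \<and> d powr t < D i powr t + e * (1/2) ^ Suc i" for i
  proof -
    have "((\<lambda>x. x powr t) \<longlongrightarrow> D i powr t) (at_right (D i))"
    proof (rule tendsto_powr2)
      show "\<forall>\<^sub>F x in at_right (D i). 0 \<le> x"
        using eventually_at_right_less[of "D i"] by eventually_elim (use D(1)[of i] in simp)
    qed (use t in auto)
    then have "\<forall>\<^sub>F x in at_right (D i). x powr t < D i powr t + e * (1/2) ^ Suc i"
      using e by (intro order_tendstoD) auto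
    moreover have "\<forall>\<^sub>F x in at_right (D i). x \<in> {D i<..<1}"
      using D[of i] by (intro eventually_at_right_real) auto
    ultimately have "\<forall>\<^sub>F x in at_right (D i). x powr t < D i powr t + e * (1/2) ^ Suc i \<and> x \<in> {D i<..<1}"
      by (rule eventually_conj)
    then obtain x where "x powr t < D i powr t + e * (1/2) ^ Suc i \<and> x \<in> {D i<..<1}"
      using eventually_happens'[OF trivial_limit_at_right_real] by blast
    then show ?thesis by (intro exI[of _ x]) auto
  qed
  then obtain d where d: "\<And>i. D i < d i" "\<And>i. d i \<le> 1" "\<And>i. d i powr t < D i powr t + e * (1/2) ^ Suc i"
    by metis
  \<comment> \<open>Thickening by half the gap on each side keeps distances below
    \<open>D i + (d i - D i) = d i\<close>.\<close>
  define V where "V i = (\<Union>y\<in>U i. ball y ((d i - D i) / 2))" for i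
  show ?thesis
  proof (rule that)
    show "open (V i)" for i by (auto simp: V_def)
    show "U i \<subseteq> V i" for i using d(1)[of i] by (force simp: V_def)
    show "0 < d i" for i using d(1)[of i] D(1)[of i] by simp
    show "d i \<le> 1" for i by (rule d)
    show "dist x y \<le> d i" if xy: "x \<in> V i" "y \<in> V i" for i x y
    proof -
      obtain x' where x': "x' \<in> U i" "dist x' x < (d i - D i) / 2" using xy(1) by (auto simp: V_def)
      obtain y' where y': "y' \<in> U i" "dist y' y < (d i - D i) / 2" using xy(2) by (auto simp: V_def)
      have "dist x' y' \<le> D i" unfolding D_def by (rule diameter_bounded_bound[OF U(1) x'(1) y'(1)])
      moreover have "dist x y \<le> dist x' x + dist x' y' + dist y' y"
        using dist_triangle[of x y x'] dist_triangle[of x' y y'] by (simp add: dist_commute)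
      ultimately show ?thesis using x'(2) y'(2) by argo
    qed
    show "(\<Sum>i\<in>I. d i powr t) \<le> 2 * e" if I: "finite I" for I
    proof -
      have "ennreal (\<Sum>i\<in>I. D i powr t) = (\<Sum>i\<in>I. hcost t (U i))"
        by (simp add: hcost_eq D_def)
      also have "\<dots> \<le> (\<Sum>i. hcost t (U i))" by (rule sum_le_suminf) (use I in auto)
      finally have 1: "(\<Sum>i\<in>I. D i powr t) \<le> e"
        using s e by (metis ennreal_le_iff less_imp_le order_le_less_trans)
      have ps: "(\<lambda>i. (1/2::real) ^ Suc i) sums 1" by (rule power_half_series)
      have "(\<Sum>i\<in>I. (1/2::real) ^ Suc i) \<le> (\<Sum>i. (1/2::real) ^ Suc i)"
        by (rule sum_le_suminf[OF sums_summable[OF ps] I]) auto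
      then have 2: "(\<Sum>i\<in>I. (1/2::real) ^ Suc i) \<le> 1" using sums_unique[OF ps] by simp
      have "(\<Sum>i\<in>I. d i powr t) \<le> (\<Sum>i\<in>I. D i powr t + e * (1/2) ^ Suc i)"
        by (intro sum_mono less_imp_le d)
      also have "\<dots> = (\<Sum>i\<in>I. D i powr t) + e * (\<Sum>i\<in>I. (1/2) ^ Suc i)"
        by (simp only: sum.distrib sum_distrib_left)
      also have "\<dots> \<le> e + e * 1" using 1 2 e by (intro add_mono mult_left_mono) auto
      finally show ?thesis by simp
    qed
  qed
qed

lemma ex_power_bracket:
  fixes \<rho> d :: real
  assumes "0 < \<rho>" "\<rho> < 1" "0 < d" "d \<le> 1"
  obtains n where "d \<le> \<rho> ^ n" "\<rho> ^ Suc n < d"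
proof -
  have ex: "\<exists>n. \<rho> ^ n < d" using assms by (intro real_arch_pow_inv) auto
  define k where "k = (LEAST n. \<rho> ^ n < d)"
  have k: "\<rho> ^ k < d" unfolding k_def using ex by (rule LeastI_ex)
  then have "k \<noteq> 0" using assms by (cases k) auto
  then obtain n where n: "k = Suc n" by (cases k) auto
  have "\<not> \<rho> ^ n < d" using not_less_Least[of n "\<lambda>n. \<rho> ^ n < d"] n by (simp add: k_def)
  then show ?thesis using that[of n] k n by simp
qed

text \<open>A cheap cover of \<open>A_set z\<close> is made finite and tested against the regular
  words of some length M. Points in one piece of size about \<open>\<rho>^m\<close> have close
  prefixes of length m, so the piece catches at most \<open>A' (2 \<rho>^t)^m\<close> prefixes and
  \<open>2^(M - m)\<close> continuations of each, about \<open>2^M d^t\<close> words. A cover of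
  total cost \<open>2 * e\<close> cannot catch the required \<open>2^M / 2\<close>.\<close>

lemma hausdorff_measure_A_set_neq_0:
  fixes z :: complex
  assumes z: "0 < norm z" "norm z < 1" and K: "1 + 2 / (1 - norm z) \<le> K"
    and A: "\<And>m. real (card (close_pairs K z m)) \<le> A * 2 powr (real m * (1 + \<epsilon>))"
    and t: "2 powr (\<epsilon> - 1) < norm z powr t" "0 < t"
  shows "hausdorff_measure t (A_set z) \<noteq> 0"
proof
  assume H0: "hausdorff_measure t (A_set z) = 0"
  define \<rho> where "\<rho> = norm z"
  have \<rho>: "0 < \<rho>" "\<rho> < 1" using z by (auto simp: \<rho>_def)
  have K0: "0 < K"
  proof -
    have "0 < 2 / (1 - norm z)" using z by simp
    then show ?thesis using K by linarith
  qed
  have A0: "0 < A"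
  proof -
    have "close_pairs K z 0 = {([], [])}" using K0 by (auto simp: close_pairs_def words_def)
    then show ?thesis using A[of 0] by simp
  qed
  obtain A' where A': "0 < A'"
    "\<And>M. 2 ^ M / 2 \<le> real (card {u \<in> words M. \<forall>n\<le>M.
      real (card {w \<in> words n. norm (wsum z (take n u) - wsum z w) \<le> K * norm z ^ n}) \<le> A' * (2 * norm z powr t) ^ n})"
    using many_regular_words[OF z(1) A t(1) A0] by blast
  \<comment> \<open>Makes the final count \<open>2^M / 4\<close>, strictly below
    \<open>2^M / 2\<close>.\<close>
  define e where "e = \<rho> powr t / (8 * A')"
  have e: "0 < e" using A' \<rho> by (simp add: e_def)
  have "hausdorff_pre t (1/2) (A_set z) < ennreal e"
    using H0 e by (simp add: hausdorff_measure_eq_0_iff)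
  then obtain U where U: "A_set z \<subseteq> (\<Union>i. U i)" "\<And>i. bounded (U i)" "\<And>i. diameter (U i) \<le> 1/2"
    "(\<Sum>i. hcost t (U i)) < ennreal e"
    by (rule hausdorff_pre_coverE) blast
  obtain V d where V: "\<And>i. open (V i)" "\<And>i. U i \<subseteq> V i" "\<And>i. 0 < d i" "\<And>i. d i \<le> 1"
    "\<And>i x y. x \<in> V i \<Longrightarrow> y \<in> V i \<Longrightarrow> dist x y \<le> d i"
    and dsum: "\<And>I. finite I \<Longrightarrow> (\<Sum>i\<in>I. d i powr t) \<le> 2 * e"
    using thickened_cover[OF U(2,3) t(2) e U(4)] by blast
  have "A_set z \<subseteq> (\<Union>i\<in>UNIV. V i)" using U(1) V(2) by blast
  then obtain I where I: "finite I" "A_set z \<subseteq> (\<Union>i\<in>I. V i)"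
    using compactE_image[OF compact_A_set[OF z(2)], of UNIV V] V(1) by metis
  have "\<exists>n. d i \<le> \<rho> ^ n \<and> \<rho> ^ Suc n < d i" for i
    using ex_power_bracket[OF \<rho> V(3) V(4)] by metis
  then obtain n where n: "\<And>i. d i \<le> \<rho> ^ n i" "\<And>i. \<rho> ^ Suc (n i) < d i" by metis
  \<comment> \<open>Words of this length resolve every piece; 0 is inserted to keep
    \<open>Max\<close> defined.\<close>
  define M where "M = Max (insert 0 (n ` I))"
  have nM: "n i \<le> M" if "i \<in> I" for i using that I(1) by (auto simp: M_def)
  define G where "G = {u \<in> words M. \<forall>n\<le>M.
      real (card {w \<in> words n. norm (wsum z (take n u) - wsum z w) \<le> K * \<rho> ^ n}) \<le> A' * (2 * \<rho> powr t) ^ n}"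
  have cG: "2 ^ M / 2 \<le> real (card G)" using A'(2)[of M] by (simp add: G_def \<rho>_def)
  have fG: "finite G" by (simp add: G_def)
  \<comment> \<open>An arbitrary constant continuation turns a word into a point of the
    attractor.\<close>
  define a where "a u k = (if k < M then u ! k else 1)" for u :: "int list" and k
  define p where "p u = (\<Sum>k. of_int (a u k) * z ^ k)" for u
  have aw: "a u k \<in> {-1, 1}" if "u \<in> words M" for u k
    using words_nth[OF that, of k] by (auto simp: a_def)
  have tk: "map (a u) [0..<m] = take m u" if "u \<in> words M" "m \<le> M" for u m
    using that length_words[OF that(1)] by (intro nth_equalityI) (auto simp: a_def)
  have pA: "p u \<in> A_set z" if "u \<in> words M" for u
    unfolding A_set_def p_def using aw[OF that] by blast
  have ptail: "norm (p u - wsum z (take m u)) \<le> \<rho> ^ m / (1 - \<rho>)" if u: "u \<in> words M" and m: "m \<le> M" for u m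
    using norm_sign_tail_le[of "a u" z m, OF aw[OF u] z(2)] tk[OF u m] by (simp add: p_def \<rho>_def)
  have part: "real (card {u \<in> G. p u \<in> V i}) \<le> 2 ^ M * (A' * (d i powr t / \<rho> powr t))" if i: "i \<in> I" for i
  proof (cases "{u \<in> G. p u \<in> V i} = {}")
    case True
    show ?thesis unfolding True using A'(1) by simp
  next
    case False
    then obtain v where v: "v \<in> G" "p v \<in> V i" by blast
    define m where "m = n i"
    have m: "m \<le> M" using nM[OF i] by (simp add: m_def)
    define C where "C = {w \<in> words m. norm (wsum z (take m v) - wsum z w) \<le> K * \<rho> ^ m}"
    have cC: "real (card C) \<le> A' * (2 * \<rho> powr t) ^ m" using v m by (simp add: G_def C_def)
    have "{u \<in> G. p u \<in> V i} \<subseteq> {u \<in> words M. take m u \<in> C}"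
    proof safe
      fix u assume u: "u \<in> G" "p u \<in> V i"
      then show "u \<in> words M" by (simp add: G_def)
      have uw: "u \<in> words M" "v \<in> words M" using u v by (auto simp: G_def)
      have "norm (p v - p u) \<le> \<rho> ^ m"
        using V(5)[OF v(2) u(2)] n(1)[of i] by (simp add: dist_norm m_def)
      moreover have "norm (wsum z (take m v) - wsum z (take m u))
        \<le> norm (p v - wsum z (take m v)) + norm (p v - p u) + norm (p u - wsum z (take m u))"
        by norm
      \<comment> \<open>This is the origin of the lower bound on K: the size of the piece plus two
        tails.\<close>
      ultimately have "norm (wsum z (take m v) - wsum z (take m u)) \<le> (1 + 2 / (1 - \<rho>)) * \<rho> ^ m"
        using ptail[OF uw(1) m] ptail[OF uw(2) m] by (simp add: algebra_simps)
      also have "\<dots> \<le> K * \<rho> ^ m" using K \<rho> by (intro mult_right_mono) (auto simp: \<rho>_def)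
      finally show "take m u \<in> C" using take_words[OF uw(1) m] by (simp add: C_def)
    qed
    then have "card {u \<in> G. p u \<in> V i} \<le> card {u \<in> words M. take m u \<in> C}"
      by (intro card_mono) auto
    also have "\<dots> \<le> card C * 2 ^ (M - m)" by (rule card_take_in_le[OF m]) (auto simp: C_def)
    finally have "real (card {u \<in> G. p u \<in> V i}) \<le> real (card C * 2 ^ (M - m))" by (simp only: of_nat_le_iff)
    also have "\<dots> = real (card C) * 2 ^ (M - m)" by simp
    also have "\<dots> \<le> A' * (2 * \<rho> powr t) ^ m * 2 ^ (M - m)" by (intro mult_right_mono cC) simp
    also have "\<dots> = (2 ^ m * 2 ^ (M - m)) * (A' * (\<rho> powr t) ^ m)" by (simp add: power_mult_distrib)
    also have "(2::real) ^ m * 2 ^ (M - m) = 2 ^ M" using m by (simp flip: power_add)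
    \<comment> \<open>Only \<open>\<rho> ^ Suc m\<close> is known to lie below \<open>d i\<close>;
      the shift by one costs the factor \<open>\<rho> powr t\<close> built into e.\<close>
    also have "(\<rho> powr t) ^ m = (\<rho> ^ Suc m) powr t / \<rho> powr t"
    proof -
      have "(\<rho> ^ Suc m) powr t = \<rho> powr t * (\<rho> ^ m) powr t" using \<rho> by (simp add: powr_mult)
      also have "(\<rho> ^ m) powr t = (\<rho> powr t) ^ m"
        using \<rho> by (simp flip: powr_realpow add: powr_powr mult.commute)
      finally show ?thesis using \<rho> by simp
    qed
    also have "2 ^ M * (A' * ((\<rho> ^ Suc m) powr t / \<rho> powr t)) \<le> 2 ^ M * (A' * (d i powr t / \<rho> powr t))"
      using n(2)[of i] \<rho> A' t
      by (intro mult_left_mono divide_right_mono powr_mono2) (auto simp: m_def)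
    finally show ?thesis .
  qed
  have "G \<subseteq> (\<Union>i\<in>I. {u \<in> G. p u \<in> V i})" using pA I(2) by (fastforce simp: G_def)
  then have "card G \<le> card (\<Union>i\<in>I. {u \<in> G. p u \<in> V i})" using fG I(1) by (intro card_mono) auto
  also have "\<dots> \<le> (\<Sum>i\<in>I. card {u \<in> G. p u \<in> V i})" by (rule card_UN_le[OF I(1)])
  finally have "real (card G) \<le> real (\<Sum>i\<in>I. card {u \<in> G. p u \<in> V i})" by (simp only: of_nat_le_iff)
  also have "\<dots> = (\<Sum>i\<in>I. real (card {u \<in> G. p u \<in> V i}))" by simp
  also have "\<dots> \<le> (\<Sum>i\<in>I. 2 ^ M * (A' * (d i powr t / \<rho> powr t)))" by (intro sum_mono part)
  also have "\<dots> = 2 ^ M * (A' / \<rho> powr t) * (\<Sum>i\<in>I. d i powr t)"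
    unfolding sum_distrib_left by (intro sum.cong) auto
  also have "\<dots> \<le> 2 ^ M * (A' / \<rho> powr t) * (2 * e)"
    using A' by (intro mult_left_mono dsum I) auto
  also have "\<dots> = 2 ^ M / 4" using A' \<rho> by (simp add: e_def)
  finally have "2 ^ M / 2 \<le> (2::real) ^ M / 4" using cG by linarith
  then show False by simp
qed

section \<open>Parameters with too many close pairs\<close>

text \<open>Pairs with a common first letter lose it: the difference of the sums is divided by z,
  which matches the change of scale from \<open>Suc m\<close> to m. The factor 2 counts the
  letter.\<close>

lemma card_close_pairs_le_Suc:
  assumes z: "z \<noteq> 0"
  shows "card (close_pairs K z (Suc m))
    \<le> card {(u, v) \<in> close_pairs K z (Suc m). hd u \<noteq> hd v} + 2 * card (close_pairs K z m)"
proof -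
  define Q where "Q = {(u, v) \<in> close_pairs K z (Suc m). hd u = hd v}"
  have fQ: "finite Q" by (rule finite_subset[of _ "close_pairs K z (Suc m)"]) (auto simp: Q_def)
  have ne: "u \<noteq> []" if "u \<in> words (Suc m)" for u using length_words[OF that] by auto
  have "inj_on (\<lambda>(u, v). (hd u, (tl u, tl v))) Q"
  proof (rule inj_onI, clarify)
    fix u v u' v' assume *: "(u, v) \<in> Q" "(u', v') \<in> Q" "hd u = hd u'" "tl u = tl u'" "tl v = tl v'"
    then have "hd v = hd v'" by (simp add: Q_def)
    moreover have "u \<noteq> []" "v \<noteq> []" "u' \<noteq> []" "v' \<noteq> []"
      using * ne by (auto simp: Q_def close_pairs_def)
    ultimately show "u = u' \<and> v = v'" using * by (metis list.collapse)
  qed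
  moreover have "(\<lambda>(u, v). (hd u, (tl u, tl v))) ` Q \<subseteq> {-1, 1} \<times> close_pairs K z m"
  proof (clarify)
    fix u v assume uv: "(u, v) \<in> Q"
    then have w: "u \<in> words (Suc m)" "v \<in> words (Suc m)" and h: "hd u = hd v"
      and n: "norm (wsum z u - wsum z v) \<le> K * norm z ^ Suc m"
      by (auto simp: Q_def close_pairs_def)
    obtain x xs where u: "u = x # xs" using ne[OF w(1)] by (cases u) auto
    obtain y ys where v: "v = y # ys" using ne[OF w(2)] by (cases v) auto
    have "wsum z u - wsum z v = z * (wsum z xs - wsum z ys)"
      using wsum_append[of z "[x]" xs] wsum_append[of z "[y]" ys] h u v
      by (simp add: wsum_def algebra_simps)
    then have "norm z * norm (wsum z xs - wsum z ys) \<le> norm z * (K * norm z ^ m)"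
      using n by (simp add: norm_mult mult_ac)
    then have "norm (wsum z xs - wsum z ys) \<le> K * norm z ^ m" using z by simp
    moreover have "x \<in> {-1, 1}" "xs \<in> words m" "ys \<in> words m" using w u v by (auto simp: words_def)
    ultimately show "hd u \<in> {-1, 1} \<and> (tl u, tl v) \<in> close_pairs K z m"
      using u v by (simp add: close_pairs_def)
  qed
  ultimately have "card Q \<le> card ({-1, 1::int} \<times> close_pairs K z m)"
    by (rule card_inj_on_le) auto
  then have cQ: "card Q \<le> 2 * card (close_pairs K z m)" by (simp add: card_cartesian_product)
  have "close_pairs K z (Suc m) \<subseteq> {(u, v) \<in> close_pairs K z (Suc m). hd u \<noteq> hd v} \<union> Q"
    by (auto simp: Q_def)
  then have "card (close_pairs K z (Suc m)) \<le> card ({(u, v) \<in> close_pairs K z (Suc m). hd u \<noteq> hd v} \<union> Q)"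
    using fQ finite_close_pairs
    by (intro card_mono finite_UnI finite_subset[of "{(u, v) \<in> close_pairs K z (Suc m). hd u \<noteq> hd v}" "close_pairs K z (Suc m)"]) auto
  also have "\<dots> \<le> card {(u, v) \<in> close_pairs K z (Suc m). hd u \<noteq> hd v} + card Q" by (rule card_Un_le)
  finally show ?thesis using cQ by linarith
qed

text \<open>For fixed prefixes u, v, division by \<open>z^k\<close> makes the condition on the
  suffixes a closeness condition at level \<open>m - k\<close> with the translation
  \<open>(wsum z u - wsum z v) / z^k\<close>, whence the 36.\<close>

lemma card_close_pairs_prefix_le:
  assumes z: "z \<noteq> 0" and K: "0 < K" and km: "k \<le> m" and T: "T \<subseteq> words k \<times> words k"
    and Q: "Q \<subseteq> close_pairs K z m" "\<And>u v. (u, v) \<in> Q \<Longrightarrow> (take k u, take k v) \<in> T"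
  shows "card Q \<le> card T * (36 * card (close_pairs K z (m - k)))"
proof -
  define F where "F = (\<lambda>(u, v). {(x, y) \<in> words (m - k) \<times> words (m - k).
      norm ((wsum z u - wsum z v) / z ^ k + wsum z x - wsum z y) \<le> K * norm z ^ (m - k)})"
  have fT: "finite T" by (rule finite_subset[OF T]) simp
  have fF: "finite (F p)" for p
    by (rule finite_subset[of _ "words (m - k) \<times> words (m - k)"]) (auto simp: F_def split: prod.splits)
  have cF: "card (F p) \<le> 36 * card (close_pairs K z (m - k))" for p
  proof (cases p)
    case (Pair u v)
    show ?thesis unfolding F_def close_pairs_def Pair prod.case
      using z K by (intro card_translated_close_le) auto
  qed
  have "inj_on (\<lambda>(u, v). ((take k u, take k v), (drop k u, drop k v))) Q"
    by (rule inj_onI) (auto, (metis append_take_drop_id)+)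
  moreover have "(\<lambda>(u, v). ((take k u, take k v), (drop k u, drop k v))) ` Q \<subseteq> Sigma T F"
  proof clarify
    fix u v assume uv: "(u, v) \<in> Q"
    then have w: "u \<in> words m" "v \<in> words m" and n: "norm (wsum z u - wsum z v) \<le> K * norm z ^ m"
      using Q(1) by (auto simp: close_pairs_def)
    have sp: "wsum z w = wsum z (take k w) + z ^ k * wsum z (drop k w)" if "w \<in> words m" for w
      using wsum_append[of z "take k w" "drop k w"] length_words[OF that] km by (simp add: min_def)
    let ?x = "(wsum z (take k u) - wsum z (take k v)) / z ^ k + wsum z (drop k u) - wsum z (drop k v)"
    have "wsum z u - wsum z v = z ^ k * ?x"
      using sp[OF w(1)] sp[OF w(2)] z by (simp add: field_simps)
    moreover have "norm z ^ m = norm z ^ k * norm z ^ (m - k)" using km by (simp flip: power_add)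
    ultimately have "norm z ^ k * norm ?x \<le> norm z ^ k * (K * norm z ^ (m - k))"
      using n by (simp add: norm_mult norm_power mult_ac)
    then have "norm ?x \<le> K * norm z ^ (m - k)"
      by (rule mult_left_le_imp_le) (use z in simp)
    then show "(take k u, take k v) \<in> T \<and> (drop k u, drop k v) \<in> F (take k u, take k v)"
      using Q(2)[OF uv] w drop_words by (simp add: F_def)
  qed
  moreover have "finite (Sigma T F)" using fT fF by auto
  ultimately have "card Q \<le> card (Sigma T F)" by (rule card_inj_on_le)
  also have "\<dots> = (\<Sum>p\<in>T. card (F p))" using fT fF by simp
  also have "\<dots> \<le> (\<Sum>p\<in>T. 36 * card (close_pairs K z (m - k)))" by (intro sum_mono cF)
  finally show ?thesis by simp
qed

definition excess_growth :: "real \<Rightarrow> real \<Rightarrow> complex \<Rightarrow> bool" where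
  "excess_growth K \<epsilon> z \<longleftrightarrow> (\<forall>A. \<exists>m. A * 2 powr (real m * (1 + \<epsilon>)) < real (card (close_pairs K z m)))"

text \<open>Quantitatively, z is near a simple zero of the derivative of order i: exactly the input
  of \<open>hasse_separation\<close>.\<close>

definition near_zero_pairs :: "real \<Rightarrow> real \<Rightarrow> nat \<Rightarrow> nat \<Rightarrow> complex \<Rightarrow> (int list \<times> int list) set" where
  "near_zero_pairs \<rho> \<tau> k i z = {(u, v) \<in> words k \<times> words k.
     norm (hasse k i (wdiff u v) z) \<le> \<rho> \<and> \<tau> \<le> norm (hasse k (Suc i) (wdiff u v) z)}"

lemma near_zero_pairs_subset: "near_zero_pairs \<rho> \<tau> k i z \<subseteq> words k \<times> words k"
  by (auto simp: near_zero_pairs_def)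

text \<open>The condition \<open>q \<ge> 2\<close> leaves a spare \<open>sqrt R^k\<close> between
  \<open>R^k\<close> and the threshold \<open>R^(k div q)\<close>, which later absorbs the
  polynomial factors.\<close>

lemma sqrt_power_le:
  fixes R :: real
  assumes R: "0 < R" "R < 1" and q: "2 \<le> q"
  shows "R ^ k \<le> sqrt R ^ k * R ^ (k div q)"
proof -
  have "k div q \<le> k div 2" using q by (intro div_le_mono2) auto
  then have "2 * (k div q) \<le> k" by linarith
  then have "sqrt R ^ k \<le> sqrt R ^ (2 * (k div q))" using R by (intro power_decreasing) auto
  also have "\<dots> = R ^ (k div q)" using R by (simp add: power_mult)
  finally have "sqrt R ^ k * sqrt R ^ k \<le> sqrt R ^ k * R ^ (k div q)"
    using R by (intro mult_left_mono) auto
  moreover have "sqrt R ^ k * sqrt R ^ k = R ^ k" using R by (simp flip: power_mult_distrib)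
  ultimately show ?thesis by simp
qed

lemma poly_sqrt_power_tendsto_0:
  fixes R :: real
  assumes R: "0 < R" "R < 1"
  shows "(\<lambda>k. C * real (k + 1) ^ J * sqrt R ^ k) \<longlonglongrightarrow> 0"
proof -
  have "(\<lambda>k. real (k + 1) ^ J * sqrt R ^ k) \<longlonglongrightarrow> 0"
    by (rule summable_LIMSEQ_zero[OF summable_power_mult_geometric]) (use R in auto)
  then have "(\<lambda>k. C * (real (k + 1) ^ J * sqrt R ^ k)) \<longlonglongrightarrow> C * 0" by (rule tendsto_mult_left)
  then show ?thesis by (simp add: mult.assoc)
qed

lemma hasse_truncation_uniform:
  assumes R: "0 < R" "R < 1"
  obtains C where "0 < C" "\<And>a z k (m::nat) i. (\<And>k. norm (a k) \<le> 2) \<Longrightarrow> norm z \<le> R \<Longrightarrow> k \<le> m \<Longrightarrow> i \<le> J \<Longrightarrow>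
     norm (hasse m i a z - hasse k i a z) \<le> C * real (k + 1) ^ J * R ^ k"
proof -
  have "\<exists>C>0. \<forall>a z k m. (\<forall>k. norm (a k) \<le> 2) \<longrightarrow> norm z \<le> R \<longrightarrow> k \<le> m \<longrightarrow>
     norm (hasse m i a z - hasse k i a z) \<le> C * real (k + 1) ^ i * R ^ k" for i
    using hasse_truncation[OF R, of i] by metis
  then obtain C where C: "\<And>i. 0 < C i" "\<And>i a z k m. (\<forall>k. norm (a k) \<le> 2) \<Longrightarrow> norm z \<le> R \<Longrightarrow> k \<le> m \<Longrightarrow>
     norm (hasse m i a z - hasse k i a z) \<le> C i * real (k + 1) ^ i * R ^ k"
    by metis
  show ?thesis
  proof (rule that[of "\<Sum>i\<le>J. C i"])
    show "0 < (\<Sum>i\<le>J. C i)" using C(1) by (intro sum_pos) auto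
    fix a :: "nat \<Rightarrow> complex" and z :: complex and k m i :: nat
    assume a: "\<And>k. norm (a k) \<le> 2" and z: "norm z \<le> R" and km: "k \<le> m" and i: "i \<le> J"
    have "norm (hasse m i a z - hasse k i a z) \<le> C i * real (k + 1) ^ i * R ^ k"
      using C(2) a z km by blast
    also have "\<dots> \<le> (\<Sum>i\<le>J. C i) * real (k + 1) ^ J * R ^ k"
    proof (intro mult_right_mono mult_mono)
      show "C i \<le> (\<Sum>i\<le>J. C i)" using C(1) i by (intro member_le_sum) (auto simp: less_imp_le)
      show "real (k + 1) ^ i \<le> real (k + 1) ^ J" using i by (intro power_increasing) auto
    qed (use C(1) R in \<open>auto simp: less_imp_le intro!: sum_nonneg\<close>)
    finally show "norm (hasse m i a z - hasse k i a z) \<le> (\<Sum>i\<le>J. C i) * real (k + 1) ^ J * R ^ k" .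
  qed
qed

text \<open>Close pairs crossing at order j number at most \<open>36 N (m - k j)\<close> times the
  size of \<open>T j\<close>, and the record property replaces \<open>N (m - k j)\<close> by
  \<open>N m 2^(-k j (1 + \<epsilon>))\<close>. Together they make up at least
  \<open>\<kappa> N m\<close>, so some \<open>T j\<close> is large. The constants are fixed before
  z; only the level and the order depend on it.\<close>

lemma excess_growth_imp_many_near_zero_prefixes:
  assumes R: "0 < R" "R < 1" and \<epsilon>: "0 < \<epsilon>" and K: "1 \<le> K" and q: "2 \<le> (q::nat)"
  obtains J C c where "0 < C" "0 < c"
    "\<And>z k0. z \<noteq> 0 \<Longrightarrow> norm z \<le> R \<Longrightarrow> excess_growth K \<epsilon> z \<Longrightarrow>
       \<exists>k\<ge>k0. \<exists>i\<le>J. c * 2 powr (real k * (1 + \<epsilon>))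
         \<le> real (card (near_zero_pairs (C * real (k + 1) ^ J * R ^ k) (R ^ (k div q) / 2) k i z))"
proof -
  obtain J c0 where c0: "0 < c0" and nd:
    "\<And>(m::nat) a z. 0 < m \<Longrightarrow> (\<And>k. norm (a k) \<le> 2) \<Longrightarrow> 2 \<le> norm (a 0) \<Longrightarrow> norm z \<le> R \<Longrightarrow>
      \<exists>i\<le>J. c0 \<le> norm (hasse m i a z)"
    using hasse_nondegenerate[OF R] by metis
  obtain C0 where C0: "0 < C0" and trunc:
    "\<And>a z k (m::nat) i. (\<And>k. norm (a k) \<le> 2) \<Longrightarrow> norm z \<le> R \<Longrightarrow> k \<le> m \<Longrightarrow> i \<le> J \<Longrightarrow>
     norm (hasse m i a z - hasse k i a z) \<le> C0 * real (k + 1) ^ J * R ^ k"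
    using hasse_truncation_uniform[OF R, of J] by metis
  define C where "C = K + C0"
  have C: "0 < C" using K C0 by (simp add: C_def)
  \<comment> \<open>At a record, \<open>2 * N (m - 1) \<le> 2 powr (- \<epsilon>) * N m\<close>, so
    this share of the pairs differs in the first letter.\<close>
  define \<kappa> where "\<kappa> = 1 - 2 powr (- \<epsilon>)"
  have \<kappa>: "0 < \<kappa>" using \<epsilon> by (simp add: \<kappa>_def powr_less_one)
  \<comment> \<open>Here 72 is twice the 36 of the extension count, and \<open>J + 1\<close> is the
    number of orders: if every \<open>T j\<close> were smaller, at most half of
    \<open>\<kappa> * N m\<close> would be reached.\<close>
  define c where "c = \<kappa> / (72 * real (J + 1))"
  have c: "0 < c" using \<kappa> by (simp add: c_def)
  have "(\<lambda>k. C0 * real (k + 1) ^ J * sqrt R ^ k) \<longlonglongrightarrow> 0" by (rule poly_sqrt_power_tendsto_0[OF R])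
  then have "\<forall>\<^sub>F k in sequentially. C0 * real (k + 1) ^ J * sqrt R ^ k < 1/2"
    by (rule order_tendstoD) simp
  then obtain k1 where k1: "\<And>k. k \<ge> k1 \<Longrightarrow> C0 * real (k + 1) ^ J * sqrt R ^ k < 1/2"
    unfolding eventually_sequentially by blast
  have "(\<lambda>k. K * R ^ k) \<longlonglongrightarrow> K * 0" using R by (intro tendsto_mult_left LIMSEQ_power_zero) auto
  then have "\<forall>\<^sub>F k in sequentially. K * R ^ k < c0" using c0 by (intro order_tendstoD) auto
  then obtain k2 where k2: "\<And>k. k \<ge> k2 \<Longrightarrow> K * R ^ k < c0"
    unfolding eventually_sequentially by blast
  show ?thesis
  proof (rule that[OF C c])
    fix z :: complex and k0 :: nat
    assume z0: "z \<noteq> 0" and zR: "norm z \<le> R" and ex: "excess_growth K \<epsilon> z"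
    define N where "N m = real (card (close_pairs K z m))" for m
    \<comment> \<open>A record beyond \<open>n * q ^ J\<close> keeps all scales
      \<open>m div q ^ i\<close> with \<open>i \<le> J\<close> above n.\<close>
    define n where "n = Max {k0, k1, k2, 1}"
    have n: "k0 \<le> n" "k1 \<le> n" "k2 \<le> n" "1 \<le> n" by (auto simp: n_def)
    have "\<exists>m. A < N m * 2 powr (- real m * (1 + \<epsilon>))" for A
    proof -
      obtain m where "A * 2 powr (real m * (1 + \<epsilon>)) < N m"
        using ex unfolding excess_growth_def N_def by blast
      then have "A * 2 powr (real m * (1 + \<epsilon>)) * 2 powr (- real m * (1 + \<epsilon>)) < N m * 2 powr (- real m * (1 + \<epsilon>))"
        by (intro mult_strict_right_mono) auto
      then show ?thesis by (intro exI[of _ m]) (simp add: mult.assoc flip: powr_add)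
    qed
    then obtain m where m: "n * q ^ J \<le> m" and
      rec': "\<And>l. l \<le> m \<Longrightarrow> N l * 2 powr (- real l * (1 + \<epsilon>)) \<le> N m * 2 powr (- real m * (1 + \<epsilon>))"
      using ex_record[of "\<lambda>m. N m * 2 powr (- real m * (1 + \<epsilon>))"] by metis
    have rec: "N (m - k) \<le> N m * 2 powr (- real k * (1 + \<epsilon>))" if "k \<le> m" for k
    proof -
      have "N (m - k) * 2 powr (- real (m - k) * (1 + \<epsilon>)) * 2 powr (real (m - k) * (1 + \<epsilon>))
        \<le> N m * 2 powr (- real m * (1 + \<epsilon>)) * 2 powr (real (m - k) * (1 + \<epsilon>))"
        by (intro mult_right_mono rec') auto
      then show ?thesis using that by (simp add: mult.assoc of_nat_diff algebra_simps flip: powr_add)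
    qed
    have q0: "0 < q" using q by simp
    have kn: "n \<le> m div q ^ i" if "i \<le> J" for i
    proof -
      have "n * q ^ i \<le> n * q ^ J" using q that by (intro mult_left_mono power_increasing) auto
      then have "n * q ^ i \<le> m" using m by linarith
      then show ?thesis using q0 by (simp add: less_eq_div_iff_mult_less_eq)
    qed
    have mpos: "0 < m" and nm: "n \<le> m" using kn[of 0] n by auto
    have Npos: "0 < N m"
    proof -
      have "([], []) \<in> close_pairs K z 0" using K by (simp add: close_pairs_def words_def wsum_def)
      then have "0 < N 0" unfolding N_def by (metis card_gt_0_iff empty_iff finite_close_pairs of_nat_0_less_iff)
      then have "0 < N m * 2 powr (- real m * (1 + \<epsilon>))" using rec'[of 0] by simp
      then show ?thesis by (simp add: zero_less_mult_iff)
    qed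
    define P where "P = {(u, v) \<in> close_pairs K z m. hd u \<noteq> hd v}"
    have Plarge: "\<kappa> * N m \<le> real (card P)"
    proof -
      have "card (close_pairs K z m) \<le> card P + 2 * card (close_pairs K z (m - 1))"
        using card_close_pairs_le_Suc[OF z0, of K "m - 1"] mpos by (simp add: P_def)
      then have "N m \<le> real (card P + 2 * card (close_pairs K z (m - 1)))"
        unfolding N_def by (simp only: of_nat_le_iff)
      then have "N m \<le> real (card P) + 2 * N (m - 1)" by (simp add: N_def)
      also have "2 * N (m - 1) \<le> 2 * (N m * 2 powr (- real 1 * (1 + \<epsilon>)))"
        using rec[of 1] mpos by (intro mult_left_mono) auto
      also have "\<dots> = N m * 2 powr (- \<epsilon>)"
      proof -
        have "2 powr (- real 1 * (1 + \<epsilon>)) = 2 powr (-1 + - \<epsilon>)" by simp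
        also have "\<dots> = 2 powr (- 1) * 2 powr (- \<epsilon>)" by (rule powr_add)
        also have "2 powr (-1) = (1/2 :: real)" by (simp add: powr_minus)
        finally show ?thesis by simp
      qed
      finally show ?thesis by (simp add: \<kappa>_def algebra_simps)
    qed
    define k where "k j = m div q ^ j" for j
    define T where "T j = near_zero_pairs (C * real (k j + 1) ^ J * R ^ k j) (R ^ (k j div q) / 2) (k j) j z" for j
    have pick: "\<exists>j\<le>J. (take (k j) u, take (k j) v) \<in> T j" if uv: "(u, v) \<in> P" for u v
    proof -
      have w: "u \<in> words m" "v \<in> words m" and hd: "hd u \<noteq> hd v"
        and close: "norm (wsum z u - wsum z v) \<le> K * norm z ^ m"
        using uv by (auto simp: P_def close_pairs_def)
      define a where "a = wdiff u v"
      have a: "norm (a l) \<le> 2" for l unfolding a_def by (rule norm_wdiff_le[OF w])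
      have a0: "2 \<le> norm (a 0)" unfolding a_def by (rule norm_wdiff_0[OF w mpos hd])
      have "K * norm z ^ m \<le> K * R ^ m" using zR K by (intro mult_left_mono power_mono) auto
      then have h0: "norm (hasse m 0 a z) \<le> K * R ^ m"
        using close by (simp add: a_def hasse_0_wdiff[OF w])
      obtain i where i: "i \<le> J" "c0 \<le> norm (hasse m i a z)" using nd[of m a z, OF mpos a a0 zR] by blast
      have "i \<noteq> 0"
      proof
        assume "i = 0"
        then show False using i h0 k2[of m] n nm by simp
      qed
      moreover have "R ^ (m div q ^ i) \<le> norm (hasse m i a z)"
      proof -
        have "R ^ (m div q ^ i) \<le> R ^ n" using kn[OF i(1)] R by (intro power_decreasing) auto
        also have "\<dots> \<le> K * R ^ n" using K R by simp
        also have "\<dots> \<le> c0" using k2[of n] n by simp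
        finally show ?thesis using i by simp
      qed
      ultimately have exi: "\<exists>i. i \<noteq> 0 \<and> R ^ (m div q ^ i) \<le> norm (hasse m i a z)" by blast
      \<comment> \<open>Order 0 is left out of the search: closeness bounds it by
        \<open>K * R ^ m\<close>, which need not be below \<open>R ^ m\<close>.\<close>
      define i' where "i' = (LEAST i. i \<noteq> 0 \<and> R ^ (m div q ^ i) \<le> norm (hasse m i a z))"
      have i': "i' \<noteq> 0" "R ^ (m div q ^ i') \<le> norm (hasse m i' a z)"
        unfolding i'_def using LeastI_ex[OF exi] by auto
      have "i' \<le> i" unfolding i'_def
        by (rule Least_le) (use \<open>i \<noteq> 0\<close> \<open>R ^ (m div q ^ i) \<le> norm (hasse m i a z)\<close> in blast)
      then have iJ: "i' \<le> J" using i(1) by simp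
      obtain j where j: "i' = Suc j" using i'(1) by (cases i') auto
      have jJ: "j \<le> J" "Suc j \<le> J" using iJ j by auto
      have kj: "k j \<le> m" by (simp add: k_def)
      have nk: "n \<le> k j" unfolding k_def by (rule kn[OF jJ(1)])
      have kq: "m div q ^ i' = k j div q"
        unfolding k_def j power_Suc2 by (rule div_mult2_eq)
      \<comment> \<open>For order 0 this is closeness of the pair, for the others minimality of the
        crossing.\<close>
      have hj: "norm (hasse m j a z) \<le> K * R ^ k j"
      proof (cases "j = 0")
        case True
        then show ?thesis using h0 by (simp add: k_def)
      next
        case False
        have "j < i'" using j by simp
        then have "\<not> (j \<noteq> 0 \<and> R ^ (m div q ^ j) \<le> norm (hasse m j a z))"
          unfolding i'_def by (rule not_less_Least)
        then have "norm (hasse m j a z) \<le> 1 * R ^ k j" using False by (simp add: k_def)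
        also have "\<dots> \<le> K * R ^ k j" using K R by (intro mult_right_mono) auto
        finally show ?thesis .
      qed
      have p1: "1 \<le> real (k j + 1) ^ J" by (rule one_le_power) simp
      have "norm (hasse (k j) j a z) \<le> norm (hasse m j a z) + norm (hasse m j a z - hasse (k j) j a z)"
        using norm_triangle_ineq4[of "hasse m j a z" "hasse m j a z - hasse (k j) j a z"] by simp
      also have "\<dots> \<le> K * R ^ k j + C0 * real (k j + 1) ^ J * R ^ k j"
        using hj trunc[of a z "k j" m j, OF a zR kj jJ(1)] by (rule add_mono)
      also have "\<dots> \<le> K * real (k j + 1) ^ J * R ^ k j + C0 * real (k j + 1) ^ J * R ^ k j"
        using p1 K R by (intro add_mono mult_right_mono) auto
      also have "\<dots> = C * real (k j + 1) ^ J * R ^ k j" by (simp add: C_def algebra_simps)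
      finally have up: "norm (hasse (k j) j a z) \<le> C * real (k j + 1) ^ J * R ^ k j" .
      \<comment> \<open>Truncation to the prefixes may use up at most half of the lower bound for
        order \<open>Suc j\<close>.\<close>
      have "C0 * real (k j + 1) ^ J * R ^ k j \<le> C0 * real (k j + 1) ^ J * (sqrt R ^ k j * R ^ (k j div q))"
        using C0 by (intro mult_left_mono sqrt_power_le[OF R q]) auto
      also have "\<dots> = C0 * real (k j + 1) ^ J * sqrt R ^ k j * R ^ (k j div q)" by simp
      also have "\<dots> \<le> 1/2 * R ^ (k j div q)"
        using k1[of "k j"] nk n R by (intro mult_right_mono) auto
      finally have tr: "C0 * real (k j + 1) ^ J * R ^ k j \<le> 1/2 * R ^ (k j div q)" .
      have "norm (hasse m (Suc j) a z) \<le> norm (hasse (k j) (Suc j) a z) + norm (hasse m (Suc j) a z - hasse (k j) (Suc j) a z)"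
        using norm_triangle_ineq[of "hasse (k j) (Suc j) a z" "hasse m (Suc j) a z - hasse (k j) (Suc j) a z"] by simp
      moreover have "norm (hasse m (Suc j) a z - hasse (k j) (Suc j) a z) \<le> C0 * real (k j + 1) ^ J * R ^ k j"
        by (rule trunc[of a z "k j" m "Suc j", OF a zR kj jJ(2)])
      moreover have "R ^ (k j div q) \<le> norm (hasse m (Suc j) a z)" using i'(2)[unfolded kq] unfolding j .
      ultimately have low: "R ^ (k j div q) / 2 \<le> norm (hasse (k j) (Suc j) a z)" using tr by linarith
      have "(take (k j) u, take (k j) v) \<in> T j"
        unfolding T_def near_zero_pairs_def
        using up low take_words[OF w(1) kj] take_words[OF w(2) kj]
        by (simp add: hasse_wdiff_take[OF w kj] a_def)
      then show ?thesis using jJ by blast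
    qed
    define Q where "Q j = {(u, v) \<in> P. (take (k j) u, take (k j) v) \<in> T j}" for j
    have fP: "finite P" by (rule finite_subset[of _ "close_pairs K z m"]) (auto simp: P_def)
    have fQ: "finite (Q j)" for j by (rule finite_subset[OF _ fP]) (auto simp: Q_def)
    have cQ: "real (card (Q j)) \<le> real (card (T j)) * (36 * (N m * 2 powr (- real (k j) * (1 + \<epsilon>))))" for j
    proof -
      have kj: "k j \<le> m" by (simp add: k_def)
      have "card (Q j) \<le> card (T j) * (36 * card (close_pairs K z (m - k j)))"
        by (rule card_close_pairs_prefix_le[OF z0 _ kj])
           (use K in \<open>auto simp: Q_def P_def T_def near_zero_pairs_def\<close>)
      then have "real (card (Q j)) \<le> real (card (T j) * (36 * card (close_pairs K z (m - k j))))"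
        by (simp only: of_nat_le_iff)
      also have "\<dots> = real (card (T j)) * (36 * N (m - k j))" by (simp add: N_def)
      also have "\<dots> \<le> real (card (T j)) * (36 * (N m * 2 powr (- real (k j) * (1 + \<epsilon>))))"
        by (intro mult_left_mono rec[OF kj]) auto
      finally show ?thesis .
    qed
    have "\<exists>j\<le>J. c * 2 powr (real (k j) * (1 + \<epsilon>)) \<le> real (card (T j))"
    proof (rule ccontr)
      assume "\<not> ?thesis"
      then have small: "real (card (T j)) \<le> c * 2 powr (real (k j) * (1 + \<epsilon>))" if "j \<le> J" for j
        using that by force
      have "P \<subseteq> (\<Union>j\<le>J. Q j)" using pick by (fastforce simp: Q_def)
      then have "card P \<le> card (\<Union>j\<le>J. Q j)" using fQ by (intro card_mono) auto
      also have "\<dots> \<le> (\<Sum>j\<le>J. card (Q j))" by (rule card_UN_le) simp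
      finally have "real (card P) \<le> real (\<Sum>j\<le>J. card (Q j))" by (simp only: of_nat_le_iff)
      also have "\<dots> = (\<Sum>j\<le>J. real (card (Q j)))" by simp
      also have "\<dots> \<le> (\<Sum>j\<le>J. \<kappa> / (2 * real (J + 1)) * N m)"
      proof (rule sum_mono)
        fix j assume "j \<in> {..J}"
        then have "real (card (T j)) \<le> c * 2 powr (real (k j) * (1 + \<epsilon>))" using small by simp
        then have "real (card (T j)) * (36 * (N m * 2 powr (- real (k j) * (1 + \<epsilon>))))
          \<le> c * 2 powr (real (k j) * (1 + \<epsilon>)) * (36 * (N m * 2 powr (- real (k j) * (1 + \<epsilon>))))"
          using Npos by (intro mult_right_mono) auto
        also have "\<dots> = c * 36 * N m * (2 powr (real (k j) * (1 + \<epsilon>)) * 2 powr (- real (k j) * (1 + \<epsilon>)))"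
          by (simp only: mult_ac)
        also have "2 powr (real (k j) * (1 + \<epsilon>)) * 2 powr (- real (k j) * (1 + \<epsilon>)) = (1::real)"
          by (simp flip: powr_add)
        also have "c * 36 * N m * 1 = \<kappa> / (2 * real (J + 1)) * N m"
        proof -
          have "\<kappa> / (72 * y) * 36 * N m * 1 = \<kappa> / (2 * y) * N m" for y by simp
          then show ?thesis unfolding c_def .
        qed
        finally show "real (card (Q j)) \<le> \<kappa> / (2 * real (J + 1)) * N m" using cQ[of j] by linarith
      qed
      also have "\<dots> = real (J + 1) * (\<kappa> / (2 * real (J + 1)) * N m)" by simp
      also have "\<dots> = \<kappa> * N m / 2" by (simp add: divide_simps)
      finally have "\<kappa> * N m \<le> \<kappa> * N m / 2" using Plarge by linarith
      moreover have "0 < \<kappa> * N m" using \<kappa> Npos by simp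
      ultimately show False by linarith
    qed
    then obtain j where j: "j \<le> J" "c * 2 powr (real (k j) * (1 + \<epsilon>)) \<le> real (card (T j))" by blast
    moreover have "k0 \<le> k j" using kn[OF j(1)] n unfolding k_def by linarith
    ultimately show "\<exists>k\<ge>k0. \<exists>i\<le>J. c * 2 powr (real k * (1 + \<epsilon>))
         \<le> real (card (near_zero_pairs (C * real (k + 1) ^ J * R ^ k) (R ^ (k div q) / 2) k i z))"
      unfolding T_def by blast
  qed
qed

text \<open>Each of the \<open>4^k\<close> prefix pairs belongs only to points that are within
  \<open>4 * \<rho> / \<tau>\<close> or more than \<open>e * \<tau>\<close> apart, so it serves at
  most about \<open>\<tau>^-2\<close> points of a separated set, while each point uses at least L
  pairs.\<close>

lemma cover_many_near_zero_pairs: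
  assumes R: "0 < R" "R < 1"
  obtains c where "0 < c"
    "\<And>\<rho> \<tau> L k. 0 < \<tau> \<Longrightarrow> \<tau> \<le> 1 \<Longrightarrow> 0 < L \<Longrightarrow>
      \<exists>X. finite X \<and> {z. norm z \<le> R \<and> L \<le> real (card (near_zero_pairs \<rho> \<tau> k i z))} \<subseteq> (\<Union>x\<in>X. cball x (4 * \<rho> / \<tau>))
        \<and> real (card X) \<le> c * 4 ^ k / (\<tau> ^ 2 * L)"
proof -
  obtain d where d: "0 < d" and sep:
    "\<And>(m::nat) a z z' \<rho> \<tau>. (\<And>k. norm (a k) \<le> 2) \<Longrightarrow> norm z \<le> R \<Longrightarrow> 0 < \<tau> \<Longrightarrow> \<tau> \<le> 1 \<Longrightarrow>
      norm (z' - z) \<le> d * \<tau> \<Longrightarrow> norm (hasse m i a z) \<le> \<rho> \<Longrightarrow> norm (hasse m i a z') \<le> \<rho> \<Longrightarrow>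
      \<tau> \<le> norm (hasse m (Suc i) a z) \<Longrightarrow> norm (z' - z) \<le> 4 * \<rho> / \<tau>"
    using hasse_separation[OF R] by metis
  \<comment> \<open>Ensures \<open>e * \<tau> \<le> 1\<close>, as required for the separation
    scale.\<close>
  define e where "e = min d 1"
  have e: "0 < e" "e \<le> 1" "e \<le> d" using d by (auto simp: e_def)
  show ?thesis
  proof (rule that[of "36 / e ^ 2"])
    show "0 < 36 / e ^ 2" using e by simp
    fix \<rho> \<tau> L :: real and k :: nat
    assume \<tau>: "0 < \<tau>" "\<tau> \<le> 1" and L: "0 < L"
    let ?B = "{z. norm z \<le> R \<and> L \<le> real (card (near_zero_pairs \<rho> \<tau> k i z))}"
    have et: "0 < e * \<tau>" "e * \<tau> \<le> 1" using e \<tau> by (auto simp: mult_le_one)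
    obtain X where X: "finite X" "?B \<subseteq> (\<Union>x\<in>X. cball x (4 * \<rho> / \<tau>))"
      "real (card X) \<le> real (card (words k \<times> words k)) * 36 / ((e * \<tau>) ^ 2 * L)"
    proof (rule cover_by_multiplicity[where B = ?B and P = "words k \<times> words k" and L = L
            and T = "near_zero_pairs \<rho> \<tau> k i" and \<sigma> = "e * \<tau>" and \<delta> = "4 * \<rho> / \<tau>"])
      show "?B \<subseteq> cball 0 1" using R by auto
      show "near_zero_pairs \<rho> \<tau> k i z \<subseteq> words k \<times> words k" for z by (rule near_zero_pairs_subset)
      fix p z z'
      assume z: "z \<in> ?B" "z' \<in> ?B" "p \<in> near_zero_pairs \<rho> \<tau> k i z" "p \<in> near_zero_pairs \<rho> \<tau> k i z'"
        and n: "norm (z - z') \<le> e * \<tau>"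
      obtain u v where p: "p = (u, v)" by (cases p)
      have w: "u \<in> words k" "v \<in> words k" using z p by (auto simp: near_zero_pairs_def)
      have "norm (z - z') \<le> d * \<tau>" using n mult_right_mono[OF e(3), of \<tau>] \<tau> by linarith
      then have "norm (z - z') \<le> 4 * \<rho> / \<tau>"
        by (intro sep[of "wdiff u v" z' \<tau> z k \<rho>])
           (use z \<tau> p in \<open>auto simp: near_zero_pairs_def intro: norm_wdiff_le[OF w]\<close>)
      then show "norm (z - z') \<le> 4 * \<rho> / \<tau>" .
    qed (use L et in auto)
    have "real (card (words k \<times> words k)) = 4 ^ k"
      by (simp add: card_cartesian_product card_words flip: power_mult_distrib)
    then have "real (card X) \<le> 36 / e ^ 2 * 4 ^ k / (\<tau> ^ 2 * L)"
      using X(3) by (simp add: power_mult_distrib mult_ac)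
    then show "\<exists>X. finite X \<and> ?B \<subseteq> (\<Union>x\<in>X. cball x (4 * \<rho> / \<tau>))
        \<and> real (card X) \<le> 36 / e ^ 2 * 4 ^ k / (\<tau> ^ 2 * L)" using X by blast
  qed
qed

lemma cover_many_near_zero_pairs_uniform:
  assumes R: "0 < R" "R < 1"
  obtains c where "0 < c"
    "\<And>\<rho> \<tau> L k. 0 < \<tau> \<Longrightarrow> \<tau> \<le> 1 \<Longrightarrow> 0 < L \<Longrightarrow>
      \<exists>X. finite X \<and> {z. norm z \<le> R \<and> (\<exists>i\<le>J. L \<le> real (card (near_zero_pairs \<rho> \<tau> k i z)))} \<subseteq> (\<Union>x\<in>X. cball x (4 * \<rho> / \<tau>))
        \<and> real (card X) \<le> c * 4 ^ k / (\<tau> ^ 2 * L)"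
proof -
  define covers where "covers i \<rho> \<tau> L k X \<longleftrightarrow> finite X \<and>
      {z. norm z \<le> R \<and> L \<le> real (card (near_zero_pairs \<rho> \<tau> k i z))} \<subseteq> (\<Union>x\<in>X. cball x (4 * \<rho> / \<tau>))"
    for i \<rho> \<tau> L k X
  define good where "good i c \<longleftrightarrow> (\<forall>\<rho> \<tau> L k. 0 < \<tau> \<longrightarrow> \<tau> \<le> 1 \<longrightarrow> 0 < L \<longrightarrow>
      (\<exists>X. covers i \<rho> \<tau> L k X \<and> real (card X) \<le> c * 4 ^ k / (\<tau> ^ 2 * L)))" for i c
  have "\<exists>c>0. good i c" for i
  proof -
    obtain c where "0 < c" "\<And>\<rho> \<tau> L k. 0 < \<tau> \<Longrightarrow> \<tau> \<le> 1 \<Longrightarrow> 0 < L \<Longrightarrow>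
      \<exists>X. finite X \<and> {z. norm z \<le> R \<and> L \<le> real (card (near_zero_pairs \<rho> \<tau> k i z))} \<subseteq> (\<Union>x\<in>X. cball x (4 * \<rho> / \<tau>))
        \<and> real (card X) \<le> c * 4 ^ k / (\<tau> ^ 2 * L)"
      by (rule cover_many_near_zero_pairs[OF R, of i]) blast
    then show ?thesis by (intro exI[of _ c]) (simp add: good_def covers_def conj_assoc)
  qed
  then obtain c where c: "\<And>i. 0 < c i" and cov: "\<And>i. good i (c i)" by metis
  show ?thesis
  proof (rule that[of "\<Sum>i\<le>J. c i"])
    show "0 < (\<Sum>i\<le>J. c i)" using c by (intro sum_pos) auto
    fix \<rho> \<tau> L :: real and k :: nat
    assume *: "0 < \<tau>" "\<tau> \<le> 1" "0 < L"
    have "\<exists>X. covers i \<rho> \<tau> L k X \<and> real (card X) \<le> c i * 4 ^ k / (\<tau> ^ 2 * L)" for i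
      using cov[of i] * unfolding good_def by blast
    then obtain X where cX: "\<And>i. covers i \<rho> \<tau> L k (X i)"
      and X3: "\<And>i. real (card (X i)) \<le> c i * 4 ^ k / (\<tau> ^ 2 * L)" by metis
    have X1: "finite (X i)" and
      X2: "{z. norm z \<le> R \<and> L \<le> real (card (near_zero_pairs \<rho> \<tau> k i z))} \<subseteq> (\<Union>x\<in>X i. cball x (4 * \<rho> / \<tau>))" for i
      using cX[of i] by (auto simp only: covers_def)
    have "card (\<Union>i\<le>J. X i) \<le> (\<Sum>i\<le>J. card (X i))" by (rule card_UN_le) simp
    then have "real (card (\<Union>i\<le>J. X i)) \<le> real (\<Sum>i\<le>J. card (X i))" by (simp only: of_nat_le_iff)
    also have "\<dots> = (\<Sum>i\<le>J. real (card (X i)))" by simp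
    also have "\<dots> \<le> (\<Sum>i\<le>J. c i * 4 ^ k / (\<tau> ^ 2 * L))" by (intro sum_mono X3)
    also have "\<dots> = (\<Sum>i\<le>J. c i) * 4 ^ k / (\<tau> ^ 2 * L)"
      by (simp only: sum_divide_distrib sum_distrib_right)
    finally have card: "real (card (\<Union>i\<le>J. X i)) \<le> (\<Sum>i\<le>J. c i) * 4 ^ k / (\<tau> ^ 2 * L)" .
    show "\<exists>X. finite X \<and> {z. norm z \<le> R \<and> (\<exists>i\<le>J. L \<le> real (card (near_zero_pairs \<rho> \<tau> k i z)))} \<subseteq> (\<Union>x\<in>X. cball x (4 * \<rho> / \<tau>))
        \<and> real (card X) \<le> (\<Sum>i\<le>J. c i) * 4 ^ k / (\<tau> ^ 2 * L)"
    proof (intro exI[of _ "\<Union>i\<le>J. X i"] conjI card)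
      show "finite (\<Union>i\<le>J. X i)" using X1 by simp
      show "{z. norm z \<le> R \<and> (\<exists>i\<le>J. L \<le> real (card (near_zero_pairs \<rho> \<tau> k i z)))} \<subseteq> (\<Union>x\<in>\<Union>i\<le>J. X i. cball x (4 * \<rho> / \<tau>))"
      proof clarify
        fix z i assume "norm z \<le> R" "i \<le> J" "L \<le> real (card (near_zero_pairs \<rho> \<tau> k i z))"
        then have "z \<in> (\<Union>x\<in>X i. cball x (4 * \<rho> / \<tau>))" using X2[of i] by blast
        then show "z \<in> (\<Union>x\<in>\<Union>i\<le>J. X i. cball x (4 * \<rho> / \<tau>))" using \<open>i \<le> J\<close> by blast
      qed
    qed
  qed
qed

text \<open>The left side is at most \<open>R^(-b k / q)\<close>, so any
  \<open>q \<ge> b (-ln R) / (\<epsilon> ln 2)\<close> works. This makes the weak derivative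
  threshold affordable.\<close>

lemma ex_small_loss_divisor:
  fixes R b \<epsilon> :: real
  assumes R: "0 < R" "R < 1" and b: "0 < b" and \<epsilon>: "0 < \<epsilon>"
  obtains q :: nat where "2 \<le> q" "\<And>k. (R ^ (k div q)) powr (- b) \<le> (2 powr \<epsilon>) ^ k"
proof -
  obtain n :: nat where n: "b * (- ln R) / (\<epsilon> * ln 2) \<le> real n" using real_arch_simple by blast
  define q where "q = max 2 n"
  have q: "2 \<le> q" "b * (- ln R) / (\<epsilon> * ln 2) \<le> real q" using n by (auto simp: q_def)
  then have bq: "b * (- ln R) \<le> real q * (\<epsilon> * ln 2)"
    using \<epsilon> by (subst (asm) pos_divide_le_eq) auto
  have "(R ^ (k div q)) powr (- b) \<le> (2 powr \<epsilon>) ^ k" for k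
  proof -
    have "real (k div q) * real q \<le> real k"
      by (metis div_times_less_eq_dividend of_nat_le_iff of_nat_mult)
    then have "real (k div q) * real q * (\<epsilon> * ln 2) \<le> real k * (\<epsilon> * ln 2)"
      using \<epsilon> by (intro mult_right_mono) auto
    moreover have "real (k div q) * (b * (- ln R)) \<le> real (k div q) * (real q * (\<epsilon> * ln 2))"
      by (intro mult_left_mono bq) simp
    ultimately have le: "real (k div q) * (b * (- ln R)) \<le> real k * (\<epsilon> * ln 2)" by (simp add: mult.assoc)
    have "(R ^ (k div q)) powr (- b) = exp (real (k div q) * (b * (- ln R)))"
      using R by (simp add: powr_def ln_realpow)
    also have "\<dots> \<le> exp (real k * (\<epsilon> * ln 2))" using le by simp
    also have "\<dots> = (2 powr \<epsilon>) ^ k" by (simp add: powr_def exp_of_nat_mult)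
    finally show ?thesis .
  qed
  then show ?thesis using that q by blast
qed

section \<open>Summing the covers at the critical exponent\<close>

lemma similarity_powr:
  fixes R :: real
  assumes "0 < R" "R < 1" shows "R powr (ln 2 / (- ln R)) = 1/2"
proof -
  have "ln R \<noteq> 0" using assms by simp
  then show ?thesis using assms by (simp add: powr_def exp_minus)
qed

text \<open>At level k there are about \<open>4^k / (r^2 2^(k(1 + \<epsilon>)))\<close> discs of
  diameter about \<open>R^k / r\<close>, up to a polynomial in k. As \<open>R^s = 1/2\<close>, their
  cost is a polynomial times \<open>2^(-\<epsilon> k) r^(-(2 + s))\<close>, and the choice of q
  bounds the last factor by \<open>2^(\<epsilon> k / 2)\<close>.\<close>

lemma hausdorff_measure_excess_growth_eq_0:
  fixes R :: real
  defines "s \<equiv> ln 2 / (- ln R)"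
  assumes R: "0 < R" "R < 1" and \<epsilon>: "0 < \<epsilon>" and K: "1 \<le> K"
  shows "hausdorff_measure s {z. z \<noteq> 0 \<and> norm z \<le> R \<and> excess_growth K \<epsilon> z} = 0"
proof -
  have s0: "0 < s" unfolding s_def using R by (intro divide_pos_pos) auto
  \<comment> \<open>The exponent 2 pays for the number of discs and s for their radii; half of
    \<epsilon> is spent here and half is kept for convergence.\<close>
  obtain q :: nat where q: "2 \<le> q" and qb: "\<And>k. (R ^ (k div q)) powr (- (2 + s)) \<le> (2 powr (\<epsilon> / 2)) ^ k"
    using ex_small_loss_divisor[OF R, of "2 + s" "\<epsilon> / 2"] s0 \<epsilon> by auto
  obtain J C c where C: "0 < C" and c: "0 < c" and pre:
    "\<And>z k0. z \<noteq> 0 \<Longrightarrow> norm z \<le> R \<Longrightarrow> excess_growth K \<epsilon> z \<Longrightarrow>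
       \<exists>k\<ge>k0. \<exists>i\<le>J. c * 2 powr (real k * (1 + \<epsilon>))
         \<le> real (card (near_zero_pairs (C * real (k + 1) ^ J * R ^ k) (R ^ (k div q) / 2) k i z))"
    by (rule excess_growth_imp_many_near_zero_prefixes[OF R \<epsilon> K q]) blast
  obtain d where d: "0 < d" and cov: "\<And>\<rho> \<tau> L k. 0 < \<tau> \<Longrightarrow> \<tau> \<le> 1 \<Longrightarrow> 0 < L \<Longrightarrow>
      \<exists>X. finite X \<and> {z. norm z \<le> R \<and> (\<exists>i\<le>J. L \<le> real (card (near_zero_pairs \<rho> \<tau> k i z)))} \<subseteq> (\<Union>x\<in>X. cball x (4 * \<rho> / \<tau>))
        \<and> real (card X) \<le> d * 4 ^ k / (\<tau> ^ 2 * L)"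
    by (rule cover_many_near_zero_pairs_uniform[OF R, of J]) blast
  define \<rho> where "\<rho> k = C * real (k + 1) ^ J * R ^ k" for k
  define r where "r k = R ^ (k div q)" for k
  define L where "L k = c * 2 powr (real k * (1 + \<epsilon>))" for k
  define B where "B k = {z. norm z \<le> R \<and> (\<exists>i\<le>J. L k \<le> real (card (near_zero_pairs (\<rho> k) (r k / 2) k i z)))}" for k
  \<comment> \<open>Rounds the polynomial exponent \<open>J * s\<close> up to a natural
    number.\<close>
  define p where "p = nat \<lceil>real J * s\<rceil>"
  define x where "x = 2 powr (- (\<epsilon> / 2))"
  define D where "D = 4 * d / c * (16 * C) powr s"
  have r: "0 < r k" "r k \<le> 1" for k using R by (auto simp: r_def power_le_one)
  have L: "0 < L k" for k using c by (simp add: L_def)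
  have rho: "0 < \<rho> k" for k using C R by (simp add: \<rho>_def)
  have x: "0 < x" "x < 1" using \<epsilon> by (auto simp: x_def powr_less_one)
  have main: "d * 4 ^ k / ((r k / 2) ^ 2 * L k) * (2 * (4 * \<rho> k / (r k / 2))) powr s
      \<le> D * (real (k + 1) ^ p * x ^ k)" for k
  proof -
    have e1: "(2 * (4 * \<rho> k / (r k / 2))) powr s
        = (16 * C) powr s * (real (k + 1) ^ J) powr s * (R ^ k) powr s * r k powr (- s)"
    proof -
      have "2 * (4 * \<rho> k / (r k / 2)) = 16 * C * real (k + 1) ^ J * R ^ k / r k" by (simp add: \<rho>_def)
      also have "\<dots> powr s = (16 * C * real (k + 1) ^ J * R ^ k) powr s / r k powr s"
        by (rule powr_divide)
      also have "\<dots> = (16 * C) powr s * (real (k + 1) ^ J) powr s * (R ^ k) powr s / r k powr s"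
        using C R by (simp add: powr_mult)
      finally show ?thesis by (simp only: powr_minus divide_inverse)
    qed
    have e2: "(R ^ k) powr s = (1/2) ^ k"
    proof -
      have "(R ^ k) powr s = (R powr s) ^ k"
        using R by (simp flip: powr_realpow add: powr_powr mult.commute)
      also have "R powr s = 1/2" unfolding s_def by (rule similarity_powr[OF R])
      finally show ?thesis .
    qed
    have e3: "d * 4 ^ k / ((r k / 2) ^ 2 * L k) = 4 * d / c * (4 ^ k * 2 powr (- (real k * (1 + \<epsilon>)))) * r k powr (- 2)"
    proof -
      have "r k powr (- 2) = 1 / r k ^ 2" using r[of k] by (simp add: powr_minus_divide powr_numeral)
      then show ?thesis by (simp add: L_def powr_minus_divide power_divide mult_ac)
    qed
    have e4: "(4 ^ k * 2 powr (- (real k * (1 + \<epsilon>)))) * (1/2) ^ k = (2 powr (- \<epsilon>)) ^ k"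
    proof -
      have "(4::real) ^ k * (1/2) ^ k = 2 powr (real k)" by (simp add: powr_realpow flip: power_mult_distrib)
      then have "(4 ^ k * 2 powr (- (real k * (1 + \<epsilon>)))) * (1/2) ^ k = 2 powr (real k) * 2 powr (- (real k * (1 + \<epsilon>)))"
        by (metis mult.assoc mult.commute)
      also have "\<dots> = 2 powr (- \<epsilon> * real k)" by (simp add: algebra_simps flip: powr_add)
      also have "\<dots> = (2 powr (- \<epsilon>)) ^ k" by (simp flip: powr_realpow add: powr_powr)
      finally show ?thesis .
    qed
    have e5: "r k powr (- 2) * r k powr (- s) = r k powr (- (2 + s))" by (simp flip: powr_add)
    have "d * 4 ^ k / ((r k / 2) ^ 2 * L k) * (2 * (4 * \<rho> k / (r k / 2))) powr s
      = D * (real (k + 1) ^ J) powr s * ((4 ^ k * 2 powr (- (real k * (1 + \<epsilon>)))) * (1/2) ^ k) * (r k powr (- 2) * r k powr (- s))"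
      unfolding e1 e2 e3 D_def by (simp only: mult_ac)
    also have "\<dots> = D * (real (k + 1) ^ J) powr s * (2 powr (- \<epsilon>)) ^ k * r k powr (- (2 + s))"
      unfolding e4 e5 ..
    also have "\<dots> \<le> D * real (k + 1) ^ p * (2 powr (- \<epsilon>)) ^ k * (2 powr (\<epsilon> / 2)) ^ k"
    proof (intro mult_mono)
      have "(real (k + 1) ^ J) powr s = real (k + 1) powr (real J * s)"
        by (simp flip: powr_realpow add: powr_powr)
      also have "\<dots> \<le> real (k + 1) powr (real p)"
        unfolding p_def by (intro powr_mono real_nat_ceiling_ge) simp
      also have "\<dots> = real (k + 1) ^ p" by (simp add: powr_realpow)
      finally show "(real (k + 1) ^ J) powr s \<le> real (k + 1) ^ p" .
      show "r k powr (- (2 + s)) \<le> (2 powr (\<epsilon> / 2)) ^ k" unfolding r_def by (rule qb)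
    qed (use d c in \<open>auto simp: D_def\<close>)
    also have "\<dots> = D * real (k + 1) ^ p * (2 powr (- \<epsilon>) * 2 powr (\<epsilon> / 2)) ^ k"
      by (simp add: power_mult_distrib)
    also have "2 powr (- \<epsilon>) * 2 powr (\<epsilon> / 2) = x" by (simp add: x_def flip: powr_add)
    finally show ?thesis by (simp only: mult.assoc)
  qed
  show ?thesis
  proof (rule hausdorff_measure_limsup_eq_0[where B = B and c = "\<lambda>k. D * (real (k + 1) ^ p * x ^ k)"])
    show "summable (\<lambda>k. D * (real (k + 1) ^ p * x ^ k))"
      by (rule summable_mult[OF summable_power_mult_geometric[OF x]])
    show "0 \<le> D * (real (k + 1) ^ p * x ^ k)" for k using d c x by (simp add: D_def)
    show "{z. z \<noteq> 0 \<and> norm z \<le> R \<and> excess_growth K \<epsilon> z} \<subseteq> (\<Union>k\<in>{k0..}. B k)" for k0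
    proof clarify
      fix z assume z: "z \<noteq> 0" "norm z \<le> R" "excess_growth K \<epsilon> z"
      obtain k i where "k \<ge> k0" "i \<le> J" "L k \<le> real (card (near_zero_pairs (\<rho> k) (r k / 2) k i z))"
        using pre[OF z, of k0] unfolding L_def \<rho>_def r_def by blast
      then have "z \<in> B k" "k \<in> {k0..}" using z by (auto simp: B_def)
      then show "z \<in> (\<Union>k\<in>{k0..}. B k)" by blast
    qed
    fix \<delta> :: real assume \<delta>: "0 < \<delta>"
    have "(\<lambda>k. 16 * C * real (k + 1) ^ J * sqrt R ^ k) \<longlonglongrightarrow> 0" by (rule poly_sqrt_power_tendsto_0[OF R])
    then have "\<forall>\<^sub>F k in sequentially. 16 * C * real (k + 1) ^ J * sqrt R ^ k < \<delta>"
      using \<delta> by (rule order_tendstoD)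
    then show "\<forall>\<^sub>F k in sequentially. hausdorff_pre s \<delta> (B k) \<le> ennreal (D * (real (k + 1) ^ p * x ^ k))"
    proof eventually_elim
      case (elim k)
      obtain X where X: "finite X" "B k \<subseteq> (\<Union>x\<in>X. cball x (4 * \<rho> k / (r k / 2)))"
        "real (card X) \<le> d * 4 ^ k / ((r k / 2) ^ 2 * L k)"
        using cov[of "r k / 2" "L k" "\<rho> k" k] r[of k] L[of k] unfolding B_def by auto
      have small: "2 * (4 * \<rho> k / (r k / 2)) \<le> \<delta>"
      proof -
        have "2 * (4 * \<rho> k / (r k / 2)) = 16 * C * real (k + 1) ^ J * (R ^ k / r k)" by (simp add: \<rho>_def)
        also have "\<dots> \<le> 16 * C * real (k + 1) ^ J * sqrt R ^ k"
        proof (intro mult_left_mono)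
          show "R ^ k / r k \<le> sqrt R ^ k"
            using sqrt_power_le[OF R q, of k] r[of k] by (subst pos_divide_le_eq) (auto simp: r_def)
        qed (use C in auto)
        finally show ?thesis using elim by simp
      qed
      have "hausdorff_pre s \<delta> (B k) \<le> ennreal (real (card X) * (2 * (4 * \<rho> k / (r k / 2))) powr s)"
        using r[of k] rho[of k] by (intro hausdorff_pre_finite_cover[OF X(1,2) _ small s0]) simp
      also have "\<dots> \<le> ennreal (d * 4 ^ k / ((r k / 2) ^ 2 * L k) * (2 * (4 * \<rho> k / (r k / 2))) powr s)"
        by (intro ennreal_leI mult_right_mono X(3)) simp
      also have "\<dots> \<le> ennreal (D * (real (k + 1) ^ p * x ^ k))" by (intro ennreal_leI main)
      finally show ?case .
    qed
  qed
qed

section \<open>Dimension drop\<close>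

lemma sim_dim_pos:
  assumes "0 < norm z" "norm z < 1" shows "0 < sim_dim z"
  unfolding sim_dim_def using assms by (intro divide_pos_pos) auto

lemma bdd_below_hausdorff_dim_set:
  "bdd_below {s. 0 < s \<and> hausdorff_measure s E = 0}"
  by (rule bdd_belowI[of _ 0]) auto

lemma hausdorff_dim_le:
  assumes "0 < s" "hausdorff_measure s E = 0" shows "hausdorff_dim E \<le> s"
  unfolding hausdorff_dim_def by (rule cInf_lower[OF _ bdd_below_hausdorff_dim_set]) (use assms in simp)

lemma hausdorff_dim_A_set_le:
  assumes z: "0 < norm z" "norm z < 1" shows "hausdorff_dim (A_set z) \<le> sim_dim z"
proof (rule dense_ge)
  fix t assume "sim_dim z < t"
  then show "hausdorff_dim (A_set z) \<le> t"
    using hausdorff_measure_A_set_eq_0[OF z] sim_dim_pos[OF z] by (intro hausdorff_dim_le) auto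
qed

text \<open>For such z the condition \<open>2 powr (\<epsilon> - 1) < norm z powr t\<close> is
  equivalent to \<open>t < (1 - \<epsilon>) * sim_dim z\<close>, so no smaller exponent gives a null
  set.\<close>

lemma hausdorff_dim_A_set_ge:
  assumes z: "0 < norm z" "norm z < 1" and K: "1 + 2 / (1 - norm z) \<le> K"
    and ex: "\<not> excess_growth K \<epsilon> z"
  shows "(1 - \<epsilon>) * sim_dim z \<le> hausdorff_dim (A_set z)"
  unfolding hausdorff_dim_def
proof (rule cInf_greatest)
  have "sim_dim z + 1 \<in> {s. 0 < s \<and> hausdorff_measure s (A_set z) = 0}"
    using hausdorff_measure_A_set_eq_0[OF z, of "sim_dim z + 1"] sim_dim_pos[OF z] by simp
  then show "{s. 0 < s \<and> hausdorff_measure s (A_set z) = 0} \<noteq> {}" by blast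
  fix t assume "t \<in> {s. 0 < s \<and> hausdorff_measure s (A_set z) = 0}"
  then have t: "0 < t" "hausdorff_measure t (A_set z) = 0" by auto
  show "(1 - \<epsilon>) * sim_dim z \<le> t"
  proof (rule ccontr)
    assume "\<not> ?thesis"
    then have "t < (1 - \<epsilon>) * ln 2 / (- ln (norm z))" by (simp add: sim_dim_def)
    moreover have "0 < - ln (norm z)" using z by simp
    ultimately have "t * (- ln (norm z)) < (1 - \<epsilon>) * ln 2" by (subst (asm) pos_less_divide_eq)
    then have "(\<epsilon> - 1) * ln 2 < t * ln (norm z)" by (simp add: algebra_simps)
    then have lt: "2 powr (\<epsilon> - 1) < norm z powr t" using z by (simp add: powr_def)
    obtain A where A: "\<And>m. real (card (close_pairs K z m)) \<le> A * 2 powr (real m * (1 + \<epsilon>))"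
      using ex unfolding excess_growth_def by (auto simp: not_less)
    show False using hausdorff_measure_A_set_neq_0[OF z K A lt t(1)] t(2) by blast
  qed
qed

text \<open>A strict drop violates the bound \<open>(1 - \<epsilon>) * sim_dim z\<close> for some
  \<open>\<epsilon> = 1 / (n + 1)\<close>, so countably many null sets suffice. The closeness
  constant is taken at R, where it dominates those of all smaller moduli.\<close>

lemma hausdorff_measure_dimension_drop_eq_0:
  assumes R: "0 < R" "R < 1"
  shows "hausdorff_measure (ln 2 / (- ln R))
    {z. 0 < norm z \<and> norm z < R \<and> hausdorff_dim (A_set z) < sim_dim z} = 0"
proof -
  define K where "K = 1 + 2 / (1 - R)"
  have K: "1 \<le> K" using R by (simp add: K_def)
  let ?E = "\<lambda>n::nat. {z. z \<noteq> 0 \<and> norm z \<le> R \<and> excess_growth K (1 / real (n + 1)) z}"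
  have "{z. 0 < norm z \<and> norm z < R \<and> hausdorff_dim (A_set z) < sim_dim z} \<subseteq> (\<Union>n. ?E n)"
  proof clarify
    fix z :: complex assume z: "0 < norm z" "norm z < R" and drop: "hausdorff_dim (A_set z) < sim_dim z"
    have z1: "norm z < 1" using z R by simp
    have "1 + 2 / (1 - norm z) \<le> K" unfolding K_def using z R z1 by (intro add_left_mono divide_left_mono) auto
    note ge = hausdorff_dim_A_set_ge[OF z(1) z1 this]
    have "\<exists>n. excess_growth K (1 / real (n + 1)) z"
    proof (rule ccontr)
      assume "\<not> ?thesis"
      then have "(1 - 1 / real (n + 1)) * sim_dim z \<le> hausdorff_dim (A_set z)" for n using ge by blast
      moreover have "(\<lambda>n. (1 - 1 / real (n + 1)) * sim_dim z) \<longlonglongrightarrow> sim_dim z"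
        by real_asymp
      ultimately have "sim_dim z \<le> hausdorff_dim (A_set z)" by (intro LIMSEQ_le_const2) auto
      then show False using drop by simp
    qed
    then show "z \<in> (\<Union>n. ?E n)" using z by auto
  qed
  moreover have "hausdorff_measure (ln 2 / (- ln R)) (\<Union>n. ?E n) = 0"
    by (intro hausdorff_measure_eq_0_UN hausdorff_measure_excess_growth_eq_0[OF R _ K]) simp
  ultimately show ?thesis by (rule hausdorff_measure_eq_0_subset[rotated])
qed

lemma similarity_exponent_bounds:
  fixes R :: real
  assumes "0 < R" "R < 1 / sqrt 2"
  shows "0 < ln 2 / (- ln R)" "ln 2 / (- ln R) < 2"
proof -
  have "ln R < ln (1 / sqrt 2)" using assms by (subst ln_less_cancel_iff) auto
  also have "ln (1 / sqrt 2) = - (ln 2 / 2)" by (simp add: ln_div ln_sqrt)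
  finally have *: "ln 2 / 2 < - ln R" by simp
  have "0 < ln (2::real)" by simp
  then have pos: "0 < - ln R" using * by linarith
  show "0 < ln 2 / (- ln R)" using pos by (intro divide_pos_pos) auto
  show "ln 2 / (- ln R) < 2" using * pos by (subst pos_divide_less_eq) auto
qed

text \<open>At 0 every term of the series vanishes and the defining equation reads
  \<open>1 = 0\<close>.\<close>

lemma M_set_norm_pos: "z \<in> M_set \<Longrightarrow> 0 < norm z"
  by (auto simp: M_set_def)

theorem mainTheorem14:
  shows "{z \<in> M_set \<inter> ball 0 (1 / sqrt 2). hausdorff_dim (A_set z) \<noteq> sim_dim z}
           \<in> null_sets lebesgue
    \<and> (\<forall>r R :: real. 0 < r \<and> r < R \<and> R < 1 / sqrt 2 \<longrightarrow>
         hausdorff_dim {z \<in> M_set. r < norm z \<and> norm z < R \<and>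
                                    hausdorff_dim (A_set z) < sim_dim z}
           \<le> ln 2 / (- ln R)
         \<and> ln 2 / (- ln R) < 2)"
proof (intro conjI allI impI)
  have lt1: "R < 1" if "R < 1 / sqrt 2" for R :: real
    using that by (rule less_le_trans) simp
  let ?D = "\<lambda>R. {z. 0 < norm z \<and> norm z < R \<and> hausdorff_dim (A_set z) < sim_dim z}"
  have null: "hausdorff_measure (ln 2 / (- ln R)) (?D R) = 0" if "0 < R" "R < 1 / sqrt 2" for R
    using that lt1 by (intro hausdorff_measure_dimension_drop_eq_0) auto
  {
    \<comment> \<open>Radii exhausting the open disc from inside; the shift by 2 keeps them
      positive.\<close>
    define R where "R n = (1 - 1 / real (n + 2)) * (1 / sqrt 2)" for n :: nat
    have R: "0 < R n" "R n < 1 / sqrt 2" for n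
    proof -
      have "0 < 1 / real (n + 2)" "1 / real (n + 2) < 1" by (auto simp: divide_less_eq)
      then have "0 < R n \<and> R n < 1 * (1 / sqrt 2)"
        unfolding R_def by (intro conjI mult_pos_pos mult_strict_right_mono) auto
      then show "0 < R n" "R n < 1 / sqrt 2" by auto
    qed
    have "{z \<in> M_set \<inter> ball 0 (1 / sqrt 2). hausdorff_dim (A_set z) \<noteq> sim_dim z} \<subseteq> (\<Union>n. ?D (R n))"
    proof clarify
      fix z assume z: "z \<in> M_set" "z \<in> ball 0 (1 / sqrt 2)" "hausdorff_dim (A_set z) \<noteq> sim_dim z"
      have z0: "0 < norm z" "norm z < 1 / sqrt 2" using z M_set_norm_pos by auto
      have "hausdorff_dim (A_set z) < sim_dim z"
        using hausdorff_dim_A_set_le[OF z0(1) lt1[OF z0(2)]] z(3) by simp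
      moreover have "(\<lambda>n. (1 - 1 / real (n + 2)) * w) \<longlonglongrightarrow> w" for w by real_asymp
      then have "R \<longlonglongrightarrow> 1 / sqrt 2" unfolding R_def .
      then have "\<forall>\<^sub>F n in sequentially. norm z < R n" using z0(2) by (rule order_tendstoD)
      then obtain n where "norm z < R n" using eventually_happens'[OF sequentially_bot] by blast
      ultimately have "z \<in> ?D (R n)" using z0 by simp
      then show "z \<in> (\<Union>n. ?D (R n))" by blast
    qed
    \<comment> \<open>For each radius the exponent is below 2, so a Hausdorff null set has area
      zero.\<close>
    moreover have "negligible (\<Union>n. ?D (R n))"
      by (intro negligible_Union_nat hausdorff_null_imp_negligible[OF null[OF R]]
          similarity_exponent_bounds[OF R] less_imp_le[OF similarity_exponent_bounds(2)[OF R]])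
    ultimately show "{z \<in> M_set \<inter> ball 0 (1 / sqrt 2). hausdorff_dim (A_set z) \<noteq> sim_dim z} \<in> null_sets lebesgue"
      unfolding negligible_iff_null_sets[symmetric] by (rule negligible_subset[rotated])
  }
  fix r R :: real assume *: "0 < r \<and> r < R \<and> R < 1 / sqrt 2"
  then have R: "0 < R" "R < 1 / sqrt 2" by auto
  show "ln 2 / (- ln R) < 2" by (rule similarity_exponent_bounds[OF R])
  show "hausdorff_dim {z \<in> M_set. r < norm z \<and> norm z < R \<and> hausdorff_dim (A_set z) < sim_dim z}
           \<le> ln 2 / (- ln R)"
    \<comment> \<open>The measure vanishes at the exponent itself, so the exponent belongs to the
      set whose infimum is the dimension.\<close>
    by (rule hausdorff_dim_le[OF similarity_exponent_bounds(1)[OF R] hausdorff_measure_eq_0_subset[OF null[OF R]]])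
       (use M_set_norm_pos in auto)
qed

end
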